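(* Let $R$ be a local domain, and let $B$ be a big Cohen-Macaulay $R$-module constructed from $R$ by iterated parameter module modifications. If $B'$ is any big Cohen-Macaulay $R$-module, then $\mathrm{cl}_B\subseteq \mathrm{cl}_{B'}$, i.e. $N_M^{\mathrm{cl}_B}\subseteq N_M^{\mathrm{cl}_{B'}}$ for all finitely generated $R$-modules $N\subseteq M$. As a consequence, $\mathrm{cl}_B$ is the smallest big Cohen-Macaulay module closure on $R$.
   Context: Local rings are commutative Noetherian. For an $R$-module $S$, the module closure $\mathrm{cl}_S$ is defined, for finitely generated $R$-modules $N\subseteq M$ and $u\in M$, by: $u\in N_M^{\mathrm{cl}_S}$ iff for all $s\in S$, $s\otimes u\in \operatorname{im}(S\otimes_R N\to S\otimes_R M)$. A (balanced) big Cohen-Macaulay module for a local ring $(R,m)$ is an $R$-module $B$, not necessarily finitely generated, such that every system of parameters for $R$ is a regular sequence on $B$ and $mB\ne B$. A big Cohen-Macaulay module closure is a module closure $\mathrm{cl}_B$ with $B$ a big Cohen-Macaulay module. A parameter module modification of an $R$-module $M$ is a map $$M\to M'=\frac{M\oplus Rf_1\oplus\cdots\oplus Rf_k}{R(u\oplus x_1f_1\oplus\cdots\oplus x_kf_k)},$$ where $x_1,\ldots,x_{k+1}$ ($k\ge0$) is part of a system of parameters for $R$, the $f_i$ are free generators, and $u,u_1,\ldots,u_k\in M$ satisfy $x_{k+1}u=x_1u_1+\cdots+x_ku_k$. "Constructed from $R$ by iterated parameter module modifications" means that $B$ is the direct limit of a sequence $R=M_0\to M_1\to M_2\to\cdots$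 in which each $M_t\to M_{t+1}$ is obtained by applying to $M_t$ a parameter module modification, or a (possibly infinite) family of them simultaneously. Applying a family simultaneously means the following: for each member of the family, given by part of a system of parameters $x_1,\ldots,x_{k+1}$ for $R$ and elements $u,u_1,\ldots,u_k\in M_t$ with $x_{k+1}u=x_1u_1+\cdots+x_ku_k$ (all depending on the member), one adjoins to $M_t$ its own new free generators $f_1,\ldots,f_k$ and kills the single element $u\oplus x_1f_1\oplus\cdots\oplus x_kf_k$. *)

theory Defs
  imports "HOL-Algebra.Module" "HOL-Algebra.Ring_Divisibility" "HOL-Library.Extended_Nat"
begin

text \<open>
  Modules are records of type \<open>('a, 'm) module\<close>, which extend ring records; the fields
  \<open>mult\<close> and \<open>one\<close> have no meaning for a module and are left \<open>undefined\<close> below.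
\<close>

section \<open>Local rings and systems of parameters\<close>

definition local_ring :: "('a, 'r) ring_scheme \<Rightarrow> bool" where
  "local_ring R \<longleftrightarrow> cring R \<and> noetherian_ring R \<and> (\<exists>!m. maximalideal m R)"

definition max_ideal :: "('a, 'r) ring_scheme \<Rightarrow> 'a set" where
  "max_ideal R = (THE m. maximalideal m R)"

definition krull_dim :: "('a, 'r) ring_scheme \<Rightarrow> enat" where
  "krull_dim R = Sup {enat n | n. \<exists>P. (\<forall>i\<le>n. primeideal (P i) R) \<and> (\<forall>i<n. P i \<subset> P (Suc i))}"

definition ideal_radical :: "('a, 'r) ring_scheme \<Rightarrow> 'a set \<Rightarrow> 'a set" where
  "ideal_radical R I = {a \<in> carrier R. \<exists>n::nat. a [^]\<^bsub>R\<^esub> n \<in> I}"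

definition system_of_parameters :: "('a, 'r) ring_scheme \<Rightarrow> 'a list \<Rightarrow> bool" where
  "system_of_parameters R xs \<longleftrightarrow>
     set xs \<subseteq> max_ideal R \<and> enat (length xs) = krull_dim R \<and>
     ideal_radical R (Idl\<^bsub>R\<^esub> (set xs)) = max_ideal R"

text \<open>Systems of parameters are stable under permutation, so it is enough to extend at the end.\<close>

definition part_of_system_of_parameters :: "('a, 'r) ring_scheme \<Rightarrow> 'a list \<Rightarrow> bool" where
  "part_of_system_of_parameters R xs \<longleftrightarrow> (\<exists>ys. system_of_parameters R (xs @ ys))"


section \<open>Module constructions\<close>

definition submodule_gen :: "('a, 'r) ring_scheme \<Rightarrow> ('a, 'm) module \<Rightarrow> 'm set \<Rightarrow> 'm set" where
  "submodule_gen R M A = \<Inter>{H. submodule H R M \<and> A \<subseteq> H}"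

definition fin_gen :: "('a, 'r) ring_scheme \<Rightarrow> ('a, 'm) module \<Rightarrow> bool" where
  "fin_gen R M \<longleftrightarrow> (\<exists>A. finite A \<and> A \<subseteq> carrier M \<and> submodule_gen R M A = carrier M)"

definition ideal_times_module ::
    "('a, 'r) ring_scheme \<Rightarrow> 'a set \<Rightarrow> ('a, 'm) module \<Rightarrow> 'm set" where
  "ideal_times_module R I M = submodule_gen R M {a \<odot>\<^bsub>M\<^esub> x | a x. a \<in> I \<and> x \<in> carrier M}"

definition module_hom ::
    "('a, 'r) ring_scheme \<Rightarrow> ('a, 'm) module \<Rightarrow> ('a, 'n) module \<Rightarrow> ('m \<Rightarrow> 'n) set" where
  "module_hom R M N = {f \<in> carrier M \<rightarrow> carrier N.
     (\<forall>x\<in>carrier M. \<forall>y\<in>carrier M. f (x \<oplus>\<^bsub>M\<^esub> y) = f x \<oplus>\<^bsub>N\<^esub> f y) \<and>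
     (\<forall>a\<in>carrier R. \<forall>x\<in>carrier M. f (a \<odot>\<^bsub>M\<^esub> x) = a \<odot>\<^bsub>N\<^esub> f x)}"

definition module_iso ::
    "('a, 'r) ring_scheme \<Rightarrow> ('a, 'm) module \<Rightarrow> ('a, 'n) module \<Rightarrow> ('m \<Rightarrow> 'n) set" where
  "module_iso R M N = {f \<in> module_hom R M N. bij_betw f (carrier M) (carrier N)}"

definition regular_module :: "('a, 'r) ring_scheme \<Rightarrow> ('a, 'a) module" where
  "regular_module R = \<lparr>carrier = carrier R, mult = mult R, one = one R,
     zero = zero R, add = add R, smult = mult R\<rparr>"

definition direct_sum :: "('a, 'm) module \<Rightarrow> ('a, 'n) module \<Rightarrow> ('a, 'm \<times> 'n) module" where
  "direct_sum M N = \<lparr>carrier = carrier M \<times> carrier N, mult = undefined, one = undefined,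
     zero = (\<zero>\<^bsub>M\<^esub>, \<zero>\<^bsub>N\<^esub>),
     add = (\<lambda>p q. (fst p \<oplus>\<^bsub>M\<^esub> fst q, snd p \<oplus>\<^bsub>N\<^esub> snd q)),
     smult = (\<lambda>a p. (a \<odot>\<^bsub>M\<^esub> fst p, a \<odot>\<^bsub>N\<^esub> snd p))\<rparr>"

text \<open>The free module with basis \<open>X\<close>: finitely supported functions that vanish off \<open>X\<close>.\<close>

definition free_module :: "('a, 'r) ring_scheme \<Rightarrow> 'x set \<Rightarrow> ('a, 'x \<Rightarrow> 'a) module" where
  "free_module R X = \<lparr>carrier = {p. (\<forall>x. p x \<in> carrier R) \<and> (\<forall>x. x \<notin> X \<longrightarrow> p x = \<zero>\<^bsub>R\<^esub>)
       \<and> finite {x. p x \<noteq> \<zero>\<^bsub>R\<^esub>}},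
     mult = undefined, one = undefined,
     zero = (\<lambda>x. \<zero>\<^bsub>R\<^esub>), add = (\<lambda>p q x. p x \<oplus>\<^bsub>R\<^esub> q x),
     smult = (\<lambda>a p x. a \<otimes>\<^bsub>R\<^esub> p x)\<rparr>"

definition basis_elt :: "('a, 'r) ring_scheme \<Rightarrow> 'x \<Rightarrow> 'x \<Rightarrow> 'a" where
  "basis_elt R x = (\<lambda>y. if y = x then \<one>\<^bsub>R\<^esub> else \<zero>\<^bsub>R\<^esub>)"

text \<open>
  The module \<open>M/K\<close> of cosets. The scalar multiple of a coset is again a coset: the
  summand \<open>k\<close> is needed because \<open>{a x | x \<in> X}\<close> alone may be too small.
\<close>

definition quotient_module :: "('a, 'm) module \<Rightarrow> 'm set \<Rightarrow> ('a, 'm set) module" where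
  "quotient_module M K = \<lparr>carrier = A_RCOSETS M K, mult = undefined, one = undefined,
     zero = K, add = set_add M,
     smult = (\<lambda>a X. {(a \<odot>\<^bsub>M\<^esub> x) \<oplus>\<^bsub>M\<^esub> k | x k. x \<in> X \<and> k \<in> K})\<rparr>"


section \<open>Tensor products and module closures\<close>

definition tensor_relations ::
    "('a, 'r) ring_scheme \<Rightarrow> ('a, 's) module \<Rightarrow> ('a, 'm) module \<Rightarrow> ('s \<times> 'm \<Rightarrow> 'a) set" where
  "tensor_relations R S M =
     (let F = free_module R (carrier S \<times> carrier M); d = (\<lambda>s x. basis_elt R (s, x)) in
       {d (s \<oplus>\<^bsub>S\<^esub> s') x \<ominus>\<^bsub>F\<^esub> (d s x \<oplus>\<^bsub>F\<^esub> d s' x) | s s' x.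
          s \<in> carrier S \<and> s' \<in> carrier S \<and> x \<in> carrier M} \<union>
       {d s (x \<oplus>\<^bsub>M\<^esub> x') \<ominus>\<^bsub>F\<^esub> (d s x \<oplus>\<^bsub>F\<^esub> d s x') | s x x'.
          s \<in> carrier S \<and> x \<in> carrier M \<and> x' \<in> carrier M} \<union>
       {d (a \<odot>\<^bsub>S\<^esub> s) x \<ominus>\<^bsub>F\<^esub> (a \<odot>\<^bsub>F\<^esub> d s x) | a s x.
          a \<in> carrier R \<and> s \<in> carrier S \<and> x \<in> carrier M} \<union>
       {d s (a \<odot>\<^bsub>M\<^esub> x) \<ominus>\<^bsub>F\<^esub> (a \<odot>\<^bsub>F\<^esub> d s x) | a s x.
          a \<in> carrier R \<and> s \<in> carrier S \<and> x \<in> carrier M})"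

definition tensor_kernel ::
    "('a, 'r) ring_scheme \<Rightarrow> ('a, 's) module \<Rightarrow> ('a, 'm) module \<Rightarrow> ('s \<times> 'm \<Rightarrow> 'a) set" where
  "tensor_kernel R S M =
     submodule_gen R (free_module R (carrier S \<times> carrier M)) (tensor_relations R S M)"

definition tensor_product ::
    "('a, 'r) ring_scheme \<Rightarrow> ('a, 's) module \<Rightarrow> ('a, 'm) module \<Rightarrow> ('a, ('s \<times> 'm \<Rightarrow> 'a) set) module" where
  "tensor_product R S M =
     quotient_module (free_module R (carrier S \<times> carrier M)) (tensor_kernel R S M)"

definition tensor_elt ::
    "('a, 'r) ring_scheme \<Rightarrow> ('a, 's) module \<Rightarrow> ('a, 'm) module \<Rightarrow> 's \<Rightarrow> 'm \<Rightarrow> ('s \<times> 'm \<Rightarrow> 'a) set" where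
  "tensor_elt R S M s x =
     tensor_kernel R S M +>\<^bsub>free_module R (carrier S \<times> carrier M)\<^esub> basis_elt R (s, x)"

text \<open>
  The map \<open>id \<otimes> f : S \<otimes> N \<rightarrow> S \<otimes> M\<close>: a formal combination of pairs \<open>(s, n)\<close> goes to the same
  combination of the pairs \<open>(s, f n)\<close>, and a coset goes to the coset containing the images of
  its elements.
\<close>

definition tensor_map ::
    "('a, 'r) ring_scheme \<Rightarrow> ('a, 's) module \<Rightarrow> ('a, 'n) module \<Rightarrow> ('a, 'm) module \<Rightarrow> ('n \<Rightarrow> 'm) \<Rightarrow>
     ('s \<times> 'n \<Rightarrow> 'a) set \<Rightarrow> ('s \<times> 'm \<Rightarrow> 'a) set" where
  "tensor_map R S N M f X =
     (let F = free_module R (carrier S \<times> carrier M);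
          push = (\<lambda>p. \<Oplus>\<^bsub>F\<^esub>z\<in>{z. p z \<noteq> \<zero>\<^bsub>R\<^esub>}. p z \<odot>\<^bsub>F\<^esub> basis_elt R (fst z, f (snd z)))
      in {push p \<oplus>\<^bsub>F\<^esub> k | p k. p \<in> X \<and> k \<in> tensor_kernel R S M})"

definition module_closure ::
    "('a, 'r) ring_scheme \<Rightarrow> ('a, 's) module \<Rightarrow> ('a, 'm) module \<Rightarrow> 'm set \<Rightarrow> 'm set" where
  "module_closure R S M N =
     (let N' = M\<lparr>carrier := N\<rparr> in
       {u \<in> carrier M. \<forall>s\<in>carrier S.
          tensor_elt R S M s u \<in> tensor_map R S N' M (\<lambda>x. x) ` carrier (tensor_product R S N')})"

definition closure_le :: "('a, 'r) ring_scheme \<Rightarrow>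
    (('a, 'm) module \<Rightarrow> 'm set \<Rightarrow> 'm set) \<Rightarrow> (('a, 'm) module \<Rightarrow> 'm set \<Rightarrow> 'm set) \<Rightarrow> bool" where
  "closure_le R cl cl' \<longleftrightarrow>
     (\<forall>M N. module R M \<and> fin_gen R M \<and> submodule N R M \<and> fin_gen R (M\<lparr>carrier := N\<rparr>) \<longrightarrow>
        cl M N \<subseteq> cl' M N)"


section \<open>Big Cohen-Macaulay modules\<close>

definition nonzerodivisor_on :: "('a, 'm) module \<Rightarrow> 'a \<Rightarrow> bool" where
  "nonzerodivisor_on M a \<longleftrightarrow> (\<forall>x\<in>carrier M. a \<odot>\<^bsub>M\<^esub> x = \<zero>\<^bsub>M\<^esub> \<longrightarrow> x = \<zero>\<^bsub>M\<^esub>)"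

definition regular_sequence :: "('a, 'r) ring_scheme \<Rightarrow> ('a, 'm) module \<Rightarrow> 'a list \<Rightarrow> bool" where
  "regular_sequence R M xs \<longleftrightarrow> set xs \<subseteq> carrier R \<and>
     (\<forall>i<length xs. nonzerodivisor_on
        (quotient_module M (ideal_times_module R (Idl\<^bsub>R\<^esub> (set (take i xs))) M)) (xs ! i)) \<and>
     ideal_times_module R (Idl\<^bsub>R\<^esub> (set xs)) M \<noteq> carrier M"

definition big_CM_module :: "('a, 'r) ring_scheme \<Rightarrow> ('a, 'm) module \<Rightarrow> bool" where
  "big_CM_module R B \<longleftrightarrow> module R B \<and>
     (\<forall>xs. system_of_parameters R xs \<longrightarrow> regular_sequence R B xs) \<and>
     ideal_times_module R (max_ideal R) B \<noteq> carrier B"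

text \<open>
  The closures \<open>cl\<^sub>B\<close> with \<open>B\<close> big Cohen-Macaulay. HOL cannot quantify over types, so the
  underlying type of \<open>B\<close> is an explicit argument.
\<close>

definition big_CM_module_closures :: "'b itself \<Rightarrow> ('a, 'r) ring_scheme \<Rightarrow>
    (('a, 'm) module \<Rightarrow> 'm set \<Rightarrow> 'm set) set" where
  "big_CM_module_closures T R = {module_closure R B | B :: ('a, 'b) module. big_CM_module R B}"


section \<open>Parameter module modifications\<close>

text \<open>
  The datum \<open>x\<^sub>k\<^sub>+\<^sub>1 u = x\<^sub>1 u\<^sub>1 + \<dots> + x\<^sub>k u\<^sub>k\<close>, with \<open>params = [x\<^sub>1, \<dots>, x\<^sub>k\<^sub>+\<^sub>1]\<close>,
  \<open>lhs_elt = u\<close> and \<open>rhs_elts = [u\<^sub>1, \<dots>, u\<^sub>k]\<close>.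
\<close>

record ('a, 'm) param_relation =
  params :: "'a list"
  lhs_elt :: 'm
  rhs_elts :: "'m list"

definition holds_param_relation ::
    "('a, 'r) ring_scheme \<Rightarrow> ('a, 'm) module \<Rightarrow> ('a, 'm) param_relation \<Rightarrow> bool" where
  "holds_param_relation R M c \<longleftrightarrow>
     length (params c) = Suc (length (rhs_elts c)) \<and>
     part_of_system_of_parameters R (params c) \<and>
     lhs_elt c \<in> carrier M \<and> set (rhs_elts c) \<subseteq> carrier M \<and>
     params c ! length (rhs_elts c) \<odot>\<^bsub>M\<^esub> lhs_elt c =
       (\<Oplus>\<^bsub>M\<^esub>j\<in>{..<length (rhs_elts c)}. params c ! j \<odot>\<^bsub>M\<^esub> (rhs_elts c ! j))"

text \<open>
  The modification for a family \<open>c\<close> of relations indexed by \<open>I\<close>: the new generator \<open>f\<^sub>j\<close>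
  (counted from \<open>0\<close>) of the member \<open>i\<close> is the basis element \<open>(i, j)\<close>. A single parameter module
  modification is the case of a one-element \<open>I\<close>.
\<close>

definition modification_sum :: "('a, 'r) ring_scheme \<Rightarrow> ('a, 'm) module \<Rightarrow> 'i set \<Rightarrow>
    ('i \<Rightarrow> ('a, 'm) param_relation) \<Rightarrow> ('a, 'm \<times> ('i \<times> nat \<Rightarrow> 'a)) module" where
  "modification_sum R M I c =
     direct_sum M (free_module R {(i, j). i \<in> I \<and> j < length (rhs_elts (c i))})"

definition modification_relator :: "('a, 'r) ring_scheme \<Rightarrow>
    ('i \<Rightarrow> ('a, 'm) param_relation) \<Rightarrow> 'i \<Rightarrow> 'm \<times> ('i \<times> nat \<Rightarrow> 'a)" where
  "modification_relator R c i = (lhs_elt (c i),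
     (\<lambda>(i', j). if i' = i \<and> j < length (rhs_elts (c i)) then params (c i) ! j else \<zero>\<^bsub>R\<^esub>))"

definition modification_kernel :: "('a, 'r) ring_scheme \<Rightarrow> ('a, 'm) module \<Rightarrow> 'i set \<Rightarrow>
    ('i \<Rightarrow> ('a, 'm) param_relation) \<Rightarrow> ('m \<times> ('i \<times> nat \<Rightarrow> 'a)) set" where
  "modification_kernel R M I c =
     submodule_gen R (modification_sum R M I c) (modification_relator R c ` I)"

definition modification :: "('a, 'r) ring_scheme \<Rightarrow> ('a, 'm) module \<Rightarrow> 'i set \<Rightarrow>
    ('i \<Rightarrow> ('a, 'm) param_relation) \<Rightarrow> ('a, ('m \<times> ('i \<times> nat \<Rightarrow> 'a)) set) module" where
  "modification R M I c = quotient_module (modification_sum R M I c) (modification_kernel R M I c)"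

definition modification_map :: "('a, 'r) ring_scheme \<Rightarrow> ('a, 'm) module \<Rightarrow> 'i set \<Rightarrow>
    ('i \<Rightarrow> ('a, 'm) param_relation) \<Rightarrow> 'm \<Rightarrow> ('m \<times> ('i \<times> nat \<Rightarrow> 'a)) set" where
  "modification_map R M I c x =
     modification_kernel R M I c +>\<^bsub>modification_sum R M I c\<^esub> (x, \<lambda>z. \<zero>\<^bsub>R\<^esub>)"

text \<open>
  \<open>\<phi> : M \<rightarrow> M'\<close> is, up to an isomorphism of the target, the modification map of the family. The
  isomorphism lets all modules of an iterated construction live in one type.
\<close>

definition is_modification :: "('a, 'r) ring_scheme \<Rightarrow> ('a, 'm) module \<Rightarrow> 'i set \<Rightarrow>
    ('i \<Rightarrow> ('a, 'm) param_relation) \<Rightarrow> ('m \<Rightarrow> 'n) \<Rightarrow> ('a, 'n) module \<Rightarrow> bool" where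
  "is_modification R M I c \<phi> M' \<longleftrightarrow>
     (\<forall>i\<in>I. holds_param_relation R M (c i)) \<and>
     (\<exists>h \<in> module_iso R (modification R M I c) M'.
        \<forall>x\<in>carrier M. \<phi> x = h (modification_map R M I c x))"


section \<open>Direct limits and iterated parameter module modifications\<close>

text \<open>
  The direct limit of \<open>M\<^sub>0 \<rightarrow> M\<^sub>1 \<rightarrow> \<dots>\<close> along \<open>\<phi>\<^sub>t : M\<^sub>t \<rightarrow> M\<^sub>t\<^sub>+\<^sub>1\<close>: pairs \<open>(t, x)\<close> with
  \<open>x \<in> M\<^sub>t\<close>, identified when they become equal at a later stage. The unions in \<open>add\<close> and
  \<open>smult\<close> run over all representatives, which yield a single class.
\<close>

definition transition :: "(nat \<Rightarrow> 'm \<Rightarrow> 'm) \<Rightarrow> nat \<Rightarrow> nat \<Rightarrow> 'm \<Rightarrow> 'm" where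
  "transition \<phi> t r = fold \<phi> [t..<r]"

definition limit_class :: "(nat \<Rightarrow> ('a, 'm) module) \<Rightarrow> (nat \<Rightarrow> 'm \<Rightarrow> 'm) \<Rightarrow> nat \<Rightarrow> 'm \<Rightarrow> (nat \<times> 'm) set" where
  "limit_class M \<phi> t x =
     {(s, y). y \<in> carrier (M s) \<and> (\<exists>r. t \<le> r \<and> s \<le> r \<and> transition \<phi> t r x = transition \<phi> s r y)}"

definition direct_limit ::
    "(nat \<Rightarrow> ('a, 'm) module) \<Rightarrow> (nat \<Rightarrow> 'm \<Rightarrow> 'm) \<Rightarrow> ('a, (nat \<times> 'm) set) module" where
  "direct_limit M \<phi> = \<lparr>carrier = {limit_class M \<phi> t x | t x. x \<in> carrier (M t)},
     mult = undefined, one = undefined,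
     zero = limit_class M \<phi> 0 \<zero>\<^bsub>M 0\<^esub>,
     add = (\<lambda>X Y. \<Union>{limit_class M \<phi> r (transition \<phi> t r x \<oplus>\<^bsub>M r\<^esub> transition \<phi> s r y) | t x s y r.
       (t, x) \<in> X \<and> (s, y) \<in> Y \<and> t \<le> r \<and> s \<le> r}),
     smult = (\<lambda>a X. \<Union>{limit_class M \<phi> t (a \<odot>\<^bsub>M t\<^esub> x) | t x. (t, x) \<in> X})\<rparr>"

text \<open>
  \<open>B\<close> is the direct limit of \<open>R = M\<^sub>0 \<rightarrow> M\<^sub>1 \<rightarrow> \<dots>\<close>, where \<open>\<phi>\<^sub>t : M\<^sub>t \<rightarrow> M\<^sub>t\<^sub>+\<^sub>1\<close> is the
  modification for the family \<open>c\<^sub>t\<close> indexed by \<open>I\<^sub>t\<close>. Equality with \<open>R\<close> and with the direct limit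
  is understood up to isomorphism of \<open>R\<close>-modules.
\<close>

definition constructed_by_modifications :: "('a, 'r) ring_scheme \<Rightarrow> (nat \<Rightarrow> ('a, 'm) module) \<Rightarrow>
    (nat \<Rightarrow> 'i set) \<Rightarrow> (nat \<Rightarrow> 'i \<Rightarrow> ('a, 'm) param_relation) \<Rightarrow> (nat \<Rightarrow> 'm \<Rightarrow> 'm) \<Rightarrow>
    ('a, 'b) module \<Rightarrow> bool" where
  "constructed_by_modifications R M I c \<phi> B \<longleftrightarrow>
     (\<forall>t. module R (M t)) \<and>
     module_iso R (regular_module R) (M 0) \<noteq> {} \<and>
     (\<forall>t. is_modification R (M t) (I t) (c t) (\<phi> t) (M (Suc t))) \<and>
     module_iso R (direct_limit M \<phi>) B \<noteq> {}"

end

theory Submission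
  imports Defs
begin

text \<open>
  If every element of \<open>B'\<close> is the image of one fixed \<open>s \<in> B\<close> under some homomorphism \<open>B \<rightarrow> B'\<close>, then
  \<open>cl\<^sub>B \<subseteq> cl\<^sub>B\<^sub>'\<close>: apply \<open>h \<otimes> id\<close> to an expression of \<open>s \<otimes> u\<close> as an image of an element of
  \<open>B \<otimes> N\<close>. For \<open>s\<close> take the image of \<open>1 \<in> R\<close>. Given \<open>s' \<in> B'\<close>, extend \<open>1 \<mapsto> s'\<close> stage by stage: a
  homomorphism \<open>g : M\<^sub>t \<rightarrow> B'\<close> turns a relation \<open>x\<^sub>k\<^sub>+\<^sub>1 u = x\<^sub>1 u\<^sub>1 + \<dots> + x\<^sub>k u\<^sub>k\<close> into one in \<open>B'\<close>, so
  regularity gives \<open>- g u = x\<^sub>1 b\<^sub>1 + \<dots> + x\<^sub>k b\<^sub>k\<close>, and \<open>f\<^sub>j \<mapsto> b\<^sub>j\<close> respects the relator of the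
  modification. The compatible family so obtained passes to the direct limit.
\<close>

section \<open>Homomorphisms and generated submodules\<close>

lemma module_homI:
  assumes "\<And>x. x \<in> carrier M \<Longrightarrow> f x \<in> carrier N"
    and "\<And>x y. x \<in> carrier M \<Longrightarrow> y \<in> carrier M \<Longrightarrow> f (x \<oplus>\<^bsub>M\<^esub> y) = f x \<oplus>\<^bsub>N\<^esub> f y"
    and "\<And>a x. a \<in> carrier R \<Longrightarrow> x \<in> carrier M \<Longrightarrow> f (a \<odot>\<^bsub>M\<^esub> x) = a \<odot>\<^bsub>N\<^esub> f x"
  shows "f \<in> module_hom R M N"
  using assms by (auto simp: module_hom_def)

lemma module_homD:
  assumes "f \<in> module_hom R M N"
  shows "x \<in> carrier M \<Longrightarrow> f x \<in> carrier N"
    and "x \<in> carrier M \<Longrightarrow> y \<in> carrier M \<Longrightarrow> f (x \<oplus>\<^bsub>M\<^esub> y) = f x \<oplus>\<^bsub>N\<^esub> f y"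
    and "a \<in> carrier R \<Longrightarrow> x \<in> carrier M \<Longrightarrow> f (a \<odot>\<^bsub>M\<^esub> x) = a \<odot>\<^bsub>N\<^esub> f x"
  using assms by (auto simp: module_hom_def)

lemma module_hom_comp:
  assumes "f \<in> module_hom R M N" "g \<in> module_hom R N P"
  shows "(\<lambda>x. g (f x)) \<in> module_hom R M P"
  by (rule module_homI) (simp_all add: module_homD[OF assms(1)] module_homD[OF assms(2)])

lemma module_hom_zero:
  assumes "module R M" "module R N" "f \<in> module_hom R M N"
  shows "f \<zero>\<^bsub>M\<^esub> = \<zero>\<^bsub>N\<^esub>"
proof -
  interpret M: module R M by fact
  interpret N: module R N by fact
  have "f (\<zero>\<^bsub>R\<^esub> \<odot>\<^bsub>M\<^esub> \<zero>\<^bsub>M\<^esub>) = \<zero>\<^bsub>R\<^esub> \<odot>\<^bsub>N\<^esub> f \<zero>\<^bsub>M\<^esub>"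
    by (rule module_homD(3)[OF assms(3)]) auto
  then show ?thesis using module_homD(1)[OF assms(3)] by simp
qed

lemma module_hom_neg:
  assumes "module R M" "module R N" "f \<in> module_hom R M N" "x \<in> carrier M"
  shows "f (\<ominus>\<^bsub>M\<^esub> x) = \<ominus>\<^bsub>N\<^esub> f x"
proof -
  interpret M: module R M by fact
  interpret N: module R N by fact
  have "f (\<ominus>\<^bsub>M\<^esub> x) \<oplus>\<^bsub>N\<^esub> f x = \<zero>\<^bsub>N\<^esub>"
    using module_homD(2)[OF assms(3), of "\<ominus>\<^bsub>M\<^esub> x" x] assms
    by (simp add: M.l_neg module_hom_zero[OF assms(1-3)])
  then show ?thesis
    using assms(4) by (intro N.minus_equality[symmetric]) (auto simp: module_homD[OF assms(3)])
qed

lemma module_hom_diff: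
  assumes "module R M" "module R N" "f \<in> module_hom R M N" "x \<in> carrier M" "y \<in> carrier M"
  shows "f (x \<ominus>\<^bsub>M\<^esub> y) = f x \<ominus>\<^bsub>N\<^esub> f y"
proof -
  interpret M: module R M by fact
  show ?thesis
    using assms by (simp add: a_minus_def module_homD(2)[OF assms(3)] module_hom_neg[OF assms(1-3)])
qed

lemma module_hom_finsum:
  assumes "module R M" "module R N" "f \<in> module_hom R M N" "g \<in> A \<rightarrow> carrier M"
  shows "f (\<Oplus>\<^bsub>M\<^esub>x\<in>A. g x) = (\<Oplus>\<^bsub>N\<^esub>x\<in>A. f (g x))"
proof -
  interpret M: module R M by fact
  interpret N: module R N by fact
  show ?thesis
    using assms(4)
    by (induction A rule: infinite_finite_induct)
      (auto simp: module_hom_zero[OF assms(1-3)] Pi_iff module_homD[OF assms(3)])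
qed

text \<open>Homomorphism theorem for a surjection \<open>p\<close>: by \<open>ker\<close>,
  \<open>g\<close> is constant on the fibres of \<open>p\<close>, so evaluating it at any chosen
  preimage is well defined and linear. For \<open>A\<close> only closure under the operations is
  asked, so that \<open>regular_module R\<close> and a direct limit can take its place without a
  proof that they satisfy the module axioms.\<close>

lemma module_hom_factor:
  assumes p: "p \<in> module_hom R A C" and surj: "p ` carrier A = carrier C"
    and add_closed: "\<And>x y. x \<in> carrier A \<Longrightarrow> y \<in> carrier A \<Longrightarrow> x \<oplus>\<^bsub>A\<^esub> y \<in> carrier A"
    and smult_closed: "\<And>a x. a \<in> carrier R \<Longrightarrow> x \<in> carrier A \<Longrightarrow> a \<odot>\<^bsub>A\<^esub> x \<in> carrier A"
    and g: "g \<in> module_hom R A D"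
    and ker: "\<And>x y. x \<in> carrier A \<Longrightarrow> y \<in> carrier A \<Longrightarrow> p x = p y \<Longrightarrow> g x = g y"
  shows "\<exists>h\<in>module_hom R C D. \<forall>x\<in>carrier A. h (p x) = g x"
proof -
  define h where "h = (\<lambda>y. g (inv_into (carrier A) p y))"
  have hp: "h (p x) = g x" if "x \<in> carrier A" for x
    unfolding h_def using that
    by (intro ker) (auto simp: inv_into_into f_inv_into_f)
  have "h \<in> module_hom R C D"
  proof (rule module_homI)
    show "h y \<in> carrier D" if "y \<in> carrier C" for y
      using that hp module_homD(1)[OF g] unfolding surj[symmetric] by auto
    show "h (y \<oplus>\<^bsub>C\<^esub> z) = h y \<oplus>\<^bsub>D\<^esub> h z" if "y \<in> carrier C" "z \<in> carrier C" for y z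
      using that hp unfolding surj[symmetric]
      by (auto simp: module_homD(2)[OF p, symmetric] module_homD(2)[OF g] add_closed)
    show "h (a \<odot>\<^bsub>C\<^esub> y) = a \<odot>\<^bsub>D\<^esub> h y" if "a \<in> carrier R" "y \<in> carrier C" for a y
      using that hp unfolding surj[symmetric]
      by (auto simp: module_homD(3)[OF p, symmetric] module_homD(3)[OF g] smult_closed)
  qed
  with hp show ?thesis by blast
qed

section \<open>Submodules, preimages and generated submodules\<close>

lemma submodule_zero:
  assumes "submodule H R M"
  shows "\<zero>\<^bsub>M\<^esub> \<in> H"
  using subgroup.one_closed[OF submodule.axioms(1)[OF assms]] by simp

lemma submodule_finsum:
  assumes "module R M" "submodule H R M" "f \<in> A \<rightarrow> H"
  shows "(\<Oplus>\<^bsub>M\<^esub>x\<in>A. f x) \<in> H"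
proof -
  interpret module R M by fact
  note E = submoduleE[OF assms(2)]
  show ?thesis
    using assms(3)
  proof (induction A rule: infinite_finite_induct)
    case (insert x F)
    then have "f \<in> F \<rightarrow> carrier M" "f x \<in> carrier M" using E(1) by auto
    then show ?case using insert E(5) by auto
  qed (auto simp: submodule_zero[OF assms(2)])
qed

lemma submodule_preimage:
  assumes "module R M" "module R N" "f \<in> module_hom R M N" "submodule H R N"
  shows "submodule {x \<in> carrier M. f x \<in> H} R M"
proof -
  interpret M: module R M by fact
  interpret N: module R N by fact
  note E = N.submoduleE[OF assms(4)]
  show ?thesis
    by (rule M.submoduleI)
      (auto simp: module_hom_zero[OF assms(1-3)] module_hom_neg[OF assms(1-3)]
        module_homD[OF assms(3)] submodule_zero[OF assms(4)] E)
qed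

lemma submodule_gen_least:
  "submodule H R M \<Longrightarrow> A \<subseteq> H \<Longrightarrow> submodule_gen R M A \<subseteq> H"
  by (auto simp: submodule_gen_def)

lemma submodule_gen_incl: "A \<subseteq> submodule_gen R M A"
  by (auto simp: submodule_gen_def)

lemma submodule_submodule_gen:
  assumes "module R M" "A \<subseteq> carrier M"
  shows "submodule (submodule_gen R M A) R M"
proof -
  interpret module R M by fact
  have "submodule_gen R M A \<subseteq> carrier M"
    by (rule submodule_gen_least[OF carrier_is_submodule assms(2)])
  then show ?thesis
    by (intro submoduleI)
      (auto simp: submodule_gen_def submodule_zero submoduleE)
qed

text \<open>The preimage of \<open>H\<close> is a submodule containing \<open>A\<close>, hence
  contains everything \<open>A\<close> generates. This reduces claims about generated submodules to
  their generators.\<close>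

lemma submodule_gen_hom_image:
  assumes "module R M" "module R N" "f \<in> module_hom R M N" "submodule H R N"
    and "A \<subseteq> carrier M" "f ` A \<subseteq> H" "x \<in> submodule_gen R M A"
  shows "f x \<in> H"
  using submodule_gen_least[OF submodule_preimage[OF assms(1-4)], of A] assms(5-7) by auto

text \<open>A homomorphism that kills the generators kills the submodule they generate, so it does
  not distinguish elements of one coset. This is the well-definedness needed to descend to a
  quotient.\<close>

lemma module_hom_const_on_cosets:
  assumes "module R M" "module R N" "f \<in> module_hom R M N"
    and "A \<subseteq> carrier M" "\<And>x. x \<in> A \<Longrightarrow> f x = \<zero>\<^bsub>N\<^esub>"
    and "x \<in> carrier M" "y \<in> carrier M"
    and "submodule_gen R M A +>\<^bsub>M\<^esub> x = submodule_gen R M A +>\<^bsub>M\<^esub> y"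
  shows "f x = f y"
proof -
  interpret M: module R M by fact
  interpret N: module R N by fact
  let ?K = "submodule_gen R M A"
  have K: "submodule ?K R M" by (rule submodule_submodule_gen[OF assms(1,4)])
  \<comment> \<open>The zero submodule is the target \<open>H\<close> for
    \<open>submodule_gen_hom_image\<close>, so that vanishing need only be tested on
    \<open>A\<close>.\<close>
  have zero: "submodule {\<zero>\<^bsub>N\<^esub>} R N" by (rule N.submoduleI) auto
  have "x \<in> ?K +>\<^bsub>M\<^esub> x"
    using assms(6) submodule_zero[OF K] by (force simp: a_r_coset_def' )
  then obtain k where k: "k \<in> ?K" "x = k \<oplus>\<^bsub>M\<^esub> y"
    using assms(8) by (auto simp: a_r_coset_def')
  then have kM: "k \<in> carrier M" using M.submoduleE(1)[OF K] by auto
  have "f k = \<zero>\<^bsub>N\<^esub>"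
    using submodule_gen_hom_image[OF assms(1-3) zero assms(4) _ k(1)] assms(5) by auto
  then show ?thesis using k kM assms(7) by (simp add: module_homD[OF assms(3)])
qed

section \<open>Quotient modules and the projection onto them\<close>

lemma abelian_subgroup_submodule:
  assumes "module R M" "submodule K R M"
  shows "abelian_subgroup K M"
proof -
  interpret module R M by fact
  show ?thesis
    by (intro abelian_subgroupI3 additive_subgroup.intro submodule.axioms(1)[OF assms(2)])
      (rule abelian_group_axioms)
qed

text \<open>The extra summand \<open>k\<close> in the scalar multiple fills up the coset: a(h + x) +
  k = (ah + k) + ax shows that nothing outside the coset of ax occurs, and h = 0 already yields all
  of it.\<close>

lemma quotient_module_smult_coset:
  assumes "module R M" "submodule K R M" "a \<in> carrier R" "x \<in> carrier M"
  shows "a \<odot>\<^bsub>quotient_module M K\<^esub> (K +>\<^bsub>M\<^esub> x) = K +>\<^bsub>M\<^esub> (a \<odot>\<^bsub>M\<^esub> x)"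
proof -
  interpret module R M by fact
  note E = submoduleE[OF assms(2)]
  have K: "k \<in> carrier M" if "k \<in> K" for k using E(1) that by auto
  have eq: "a \<odot>\<^bsub>M\<^esub> (h \<oplus>\<^bsub>M\<^esub> x) \<oplus>\<^bsub>M\<^esub> k = (a \<odot>\<^bsub>M\<^esub> h \<oplus>\<^bsub>M\<^esub> k) \<oplus>\<^bsub>M\<^esub> a \<odot>\<^bsub>M\<^esub> x"
    if "h \<in> K" "k \<in> K" for h k
    using that assms K by (simp add: smult_r_distr M.a_ac)
  have closed: "a \<odot>\<^bsub>M\<^esub> h \<oplus>\<^bsub>M\<^esub> k \<in> K" if "h \<in> K" "k \<in> K" for h k
    using that assms E by auto
  have rep: "a \<odot>\<^bsub>M\<^esub> (\<zero>\<^bsub>M\<^esub> \<oplus>\<^bsub>M\<^esub> x) \<oplus>\<^bsub>M\<^esub> k = k \<oplus>\<^bsub>M\<^esub> a \<odot>\<^bsub>M\<^esub> x" if "k \<in> K" for k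
    using that assms K by (simp add: M.a_comm)
  have "a \<odot>\<^bsub>quotient_module M K\<^esub> (K +>\<^bsub>M\<^esub> x)
      = {a \<odot>\<^bsub>M\<^esub> (h \<oplus>\<^bsub>M\<^esub> x) \<oplus>\<^bsub>M\<^esub> k | h k. h \<in> K \<and> k \<in> K}"
    by (auto simp: quotient_module_def a_r_coset_def')
  also have "\<dots> = {k \<oplus>\<^bsub>M\<^esub> a \<odot>\<^bsub>M\<^esub> x | k. k \<in> K}"
  proof (intro equalityI subsetI)
    fix y assume "y \<in> {k \<oplus>\<^bsub>M\<^esub> a \<odot>\<^bsub>M\<^esub> x | k. k \<in> K}"
    then obtain k where "k \<in> K" "y = a \<odot>\<^bsub>M\<^esub> (\<zero>\<^bsub>M\<^esub> \<oplus>\<^bsub>M\<^esub> x) \<oplus>\<^bsub>M\<^esub> k"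
      using rep by auto
    then show "y \<in> {a \<odot>\<^bsub>M\<^esub> (h \<oplus>\<^bsub>M\<^esub> x) \<oplus>\<^bsub>M\<^esub> k | h k. h \<in> K \<and> k \<in> K}"
      using submodule_zero[OF assms(2)] by blast
  qed (use eq closed in blast)
  also have "\<dots> = K +>\<^bsub>M\<^esub> (a \<odot>\<^bsub>M\<^esub> x)"
    by (auto simp: a_r_coset_def')
  finally show ?thesis .
qed

lemma quotient_map_hom:
  assumes "module R M" "submodule K R M"
  shows "(\<lambda>x. K +>\<^bsub>M\<^esub> x) \<in> module_hom R M (quotient_module M K)"
proof (rule module_homI)
  interpret abelian_subgroup K M by (rule abelian_subgroup_submodule[OF assms])
  show "K +>\<^bsub>M\<^esub> x \<in> carrier (quotient_module M K)" if "x \<in> carrier M" for x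
    using that by (auto simp: quotient_module_def A_RCOSETS_def')
  show "K +>\<^bsub>M\<^esub> (x \<oplus>\<^bsub>M\<^esub> y) = (K +>\<^bsub>M\<^esub> x) \<oplus>\<^bsub>quotient_module M K\<^esub> (K +>\<^bsub>M\<^esub> y)"
    if "x \<in> carrier M" "y \<in> carrier M" for x y
    using a_rcos_sum[OF that] by (simp add: quotient_module_def)
qed (simp add: quotient_module_smult_coset[OF assms])

section \<open>Free modules\<close>

lemma module_free_module:
  assumes "cring R"
  shows "module R (free_module R X)"
proof -
  interpret cring R by fact
  have fin: "finite {x. p x \<oplus>\<^bsub>R\<^esub> q x \<noteq> \<zero>\<^bsub>R\<^esub>}"
    if "finite {x. p x \<noteq> \<zero>\<^bsub>R\<^esub>}" "finite {x. q x \<noteq> \<zero>\<^bsub>R\<^esub>}" for p q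
    by (rule finite_subset[OF _ finite_UnI[OF that]]) auto
  have fin': "finite {x. a \<otimes>\<^bsub>R\<^esub> p x \<noteq> \<zero>\<^bsub>R\<^esub>}"
    if "finite {x. p x \<noteq> \<zero>\<^bsub>R\<^esub>}" "a \<in> carrier R" for p a
    by (rule finite_subset[OF _ that(1)]) (use that in auto)
  have fin'': "finite {x. \<ominus>\<^bsub>R\<^esub> p x \<noteq> \<zero>\<^bsub>R\<^esub>}" if "finite {x. p x \<noteq> \<zero>\<^bsub>R\<^esub>}" for p
    by (rule finite_subset[OF _ that]) auto
  show ?thesis
  proof (rule moduleI)
    show "abelian_group (free_module R X)"
    proof (rule abelian_groupI)
      show "\<exists>q\<in>carrier (free_module R X). q \<oplus>\<^bsub>free_module R X\<^esub> p = \<zero>\<^bsub>free_module R X\<^esub>"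
        if "p \<in> carrier (free_module R X)" for p
        using that
        by (intro bexI[of _ "\<lambda>x. \<ominus>\<^bsub>R\<^esub> p x"]) (auto simp: free_module_def fin'' l_neg)
    qed (auto simp: free_module_def fin a_ac)
  qed (auto simp: free_module_def fin' l_distr r_distr m_assoc assms)
qed

lemma free_module_support:
  "p \<in> carrier (free_module R X) \<Longrightarrow> {x. p x \<noteq> \<zero>\<^bsub>R\<^esub>} \<subseteq> X"
  by (auto simp: free_module_def)

lemma basis_elt_closed:
  assumes "cring R" "x \<in> X"
  shows "basis_elt R x \<in> carrier (free_module R X)"
proof -
  interpret cring R by fact
  have "finite {y. basis_elt R x y \<noteq> \<zero>\<^bsub>R\<^esub>}"
    by (rule finite_subset[of _ "{x}"]) (auto simp: basis_elt_def)
  then show ?thesis using assms(2) by (auto simp: free_module_def basis_elt_def)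
qed

text \<open>The linear extension of \<open>g\<close> from the basis to the free module. The sum runs
  over the support of \<open>p\<close>, because the basis may be infinite and \<open>finsum\<close>
  over an infinite set is zero by default.\<close>

definition free_ext :: "('a, 'r) ring_scheme \<Rightarrow> ('a, 'm) module \<Rightarrow> ('x \<Rightarrow> 'm) \<Rightarrow> ('x \<Rightarrow> 'a) \<Rightarrow> 'm" where
  "free_ext R M g p = (\<Oplus>\<^bsub>M\<^esub>x\<in>{x. p x \<noteq> \<zero>\<^bsub>R\<^esub>}. p x \<odot>\<^bsub>M\<^esub> g x)"

text \<open>Terms outside the support are zero, so any finite index set between the support and
  \<open>X\<close> gives the same sum. This allows several elements to be evaluated over one common
  index set.\<close>

lemma free_ext_eq:
  assumes "module R M" "g \<in> X \<rightarrow> carrier M" "p \<in> carrier (free_module R X)"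
    and "finite A" "{x. p x \<noteq> \<zero>\<^bsub>R\<^esub>} \<subseteq> A" "A \<subseteq> X"
  shows "free_ext R M g p = (\<Oplus>\<^bsub>M\<^esub>x\<in>A. p x \<odot>\<^bsub>M\<^esub> g x)"
proof -
  interpret module R M by fact
  have p: "p x \<in> carrier R" for x using assms(3) by (auto simp: free_module_def)
  have g: "g x \<in> carrier M" if "x \<in> A" for x using that assms(2,6) by auto
  show ?thesis
    unfolding free_ext_def
    by (rule M.add.finprod_mono_neutral_cong_left[OF assms(4,5)])
      (use p g in auto)
qed

lemma free_ext_hom:
  assumes "module R M" "g \<in> X \<rightarrow> carrier M"
  shows "free_ext R M g \<in> module_hom R (free_module R X) M"
proof (rule module_homI)
  interpret module R M by fact
  let ?F = "free_module R X"
  interpret F: module R ?F by (rule module_free_module) (rule R.is_cring)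
  let ?S = "\<lambda>p. {x. p x \<noteq> \<zero>\<^bsub>R\<^esub>}"
  have F: "p x \<in> carrier R" "finite (?S p)" "?S p \<subseteq> X" if "p \<in> carrier ?F" for p x
    using that by (auto simp: free_module_def)
  note eq = free_ext_eq[OF assms]
  show "free_ext R M g p \<in> carrier M" if "p \<in> carrier ?F" for p
    unfolding free_ext_def by (rule M.finsum_closed) (use F[OF that] assms(2) in auto)
  show "free_ext R M g (p \<oplus>\<^bsub>?F\<^esub> q) = free_ext R M g p \<oplus>\<^bsub>M\<^esub> free_ext R M g q"
    if "p \<in> carrier ?F" "q \<in> carrier ?F" for p q
  proof -
    \<comment> \<open>The union serves all three sums; the support of the sum of \<open>p\<close>
      and \<open>q\<close> may be smaller because of cancellation.\<close>
    let ?A = "?S p \<union> ?S q"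
    have A: "finite ?A" "?A \<subseteq> X" using F that by auto
    have pq: "(p \<oplus>\<^bsub>?F\<^esub> q) x = p x \<oplus>\<^bsub>R\<^esub> q x" for x by (simp add: free_module_def)
    have g: "g x \<in> carrier M" if "x \<in> ?A" for x using that A(2) assms(2) by auto
    have "free_ext R M g (p \<oplus>\<^bsub>?F\<^esub> q) = (\<Oplus>\<^bsub>M\<^esub>x\<in>?A. (p \<oplus>\<^bsub>?F\<^esub> q) x \<odot>\<^bsub>M\<^esub> g x)"
      by (rule eq[OF _ A(1) _ A(2)]) (use that pq in auto)
    also have "\<dots> = (\<Oplus>\<^bsub>M\<^esub>x\<in>?A. p x \<odot>\<^bsub>M\<^esub> g x \<oplus>\<^bsub>M\<^esub> q x \<odot>\<^bsub>M\<^esub> g x)"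
      by (rule M.finsum_cong') (use g F that in \<open>auto simp: pq smult_l_distr\<close>)
    also have "\<dots> = (\<Oplus>\<^bsub>M\<^esub>x\<in>?A. p x \<odot>\<^bsub>M\<^esub> g x) \<oplus>\<^bsub>M\<^esub> (\<Oplus>\<^bsub>M\<^esub>x\<in>?A. q x \<odot>\<^bsub>M\<^esub> g x)"
      by (rule M.finsum_addf) (use g F that in auto)
    also have "(\<Oplus>\<^bsub>M\<^esub>x\<in>?A. p x \<odot>\<^bsub>M\<^esub> g x) = free_ext R M g p"
      by (rule eq[symmetric, OF _ A(1) _ A(2)]) (use that in auto)
    also have "(\<Oplus>\<^bsub>M\<^esub>x\<in>?A. q x \<odot>\<^bsub>M\<^esub> g x) = free_ext R M g q"
      by (rule eq[symmetric, OF _ A(1) _ A(2)]) (use that in auto)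
    finally show ?thesis .
  qed
  show "free_ext R M g (a \<odot>\<^bsub>?F\<^esub> p) = a \<odot>\<^bsub>M\<^esub> free_ext R M g p"
    if "a \<in> carrier R" "p \<in> carrier ?F" for a p
  proof -
    have ap: "(a \<odot>\<^bsub>?F\<^esub> p) x = a \<otimes>\<^bsub>R\<^esub> p x" for x by (simp add: free_module_def)
    have g: "g x \<in> carrier M" if "x \<in> ?S p" for x using that F(3)[OF \<open>p \<in> _\<close>] assms(2) by auto
    \<comment> \<open>Scalar multiplication can shrink the support, so the sum is taken over the
      support of \<open>p\<close> instead.\<close>
    have "free_ext R M g (a \<odot>\<^bsub>?F\<^esub> p) = (\<Oplus>\<^bsub>M\<^esub>x\<in>?S p. (a \<odot>\<^bsub>?F\<^esub> p) x \<odot>\<^bsub>M\<^esub> g x)"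
      by (rule eq[OF _ F(2)[OF that(2)] _ F(3)[OF that(2)]]) (use that in \<open>auto simp: ap\<close>)
    also have "\<dots> = (\<Oplus>\<^bsub>M\<^esub>x\<in>?S p. a \<odot>\<^bsub>M\<^esub> (p x \<odot>\<^bsub>M\<^esub> g x))"
      by (rule M.finsum_cong') (use g F that in \<open>auto simp: ap smult_assoc1\<close>)
    also have "\<dots> = a \<odot>\<^bsub>M\<^esub> free_ext R M g p"
      unfolding free_ext_def
      by (rule finsum_smult_ldistr[symmetric]) (use g F that in auto)
    finally show ?thesis .
  qed
qed

lemma free_ext_basis:
  assumes "module R M" "g \<in> X \<rightarrow> carrier M" "x \<in> X"
  shows "free_ext R M g (basis_elt R x) = g x"
proof -
  interpret module R M by fact
  \<comment> \<open>The set \<open>{x}\<close> contains the support even in the zero ring, where the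
    support is empty.\<close>
  have "free_ext R M g (basis_elt R x) = (\<Oplus>\<^bsub>M\<^esub>y\<in>{x}. basis_elt R x y \<odot>\<^bsub>M\<^esub> g y)"
    by (rule free_ext_eq[OF assms(1,2)])
      (use assms(3) basis_elt_closed[OF R.is_cring] in \<open>auto simp: basis_elt_def\<close>)
  also have "\<dots> = basis_elt R x x \<odot>\<^bsub>M\<^esub> g x \<oplus>\<^bsub>M\<^esub> \<zero>\<^bsub>M\<^esub>"
    using assms by (subst M.finsum_insert) (auto simp: basis_elt_def)
  finally show ?thesis using funcset_mem[OF assms(2,3)] by (simp add: basis_elt_def)
qed

lemma module_hom_free_ext:
  assumes "module R M" "module R N" "f \<in> module_hom R M N"
    and "g \<in> X \<rightarrow> carrier M" "p \<in> carrier (free_module R X)"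
  shows "f (free_ext R M g p) = free_ext R N (\<lambda>x. f (g x)) p"
proof -
  interpret M: module R M by fact
  interpret N: module R N by fact
  have p: "p x \<in> carrier R" "p x \<noteq> \<zero>\<^bsub>R\<^esub> \<Longrightarrow> g x \<in> carrier M" for x
    using assms(4,5) by (auto simp: free_module_def)
  have "f (free_ext R M g p) = (\<Oplus>\<^bsub>N\<^esub>x\<in>{x. p x \<noteq> \<zero>\<^bsub>R\<^esub>}. f (p x \<odot>\<^bsub>M\<^esub> g x))"
    unfolding free_ext_def by (rule module_hom_finsum[OF assms(1-3)]) (use p in auto)
  also have "\<dots> = free_ext R N (\<lambda>x. f (g x)) p"
    unfolding free_ext_def
    by (rule N.finsum_cong') (use p in \<open>auto simp: module_homD[OF assms(3)]\<close>)
  finally show ?thesis .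
qed

section \<open>Direct sums\<close>

lemma module_direct_sum:
  assumes "module R M" "module R N"
  shows "module R (direct_sum M N)"
proof -
  interpret M: module R M by fact
  interpret N: module R N by fact
  show ?thesis
  proof (rule moduleI)
    show "cring R" by (rule M.R.is_cring)
    show "abelian_group (direct_sum M N)"
    proof (rule abelian_groupI)
      show "\<exists>q\<in>carrier (direct_sum M N). q \<oplus>\<^bsub>direct_sum M N\<^esub> p = \<zero>\<^bsub>direct_sum M N\<^esub>"
        if "p \<in> carrier (direct_sum M N)" for p
        using that
        by (intro bexI[of _ "(\<ominus>\<^bsub>M\<^esub> fst p, \<ominus>\<^bsub>N\<^esub> snd p)"])
          (auto simp: direct_sum_def M.l_neg N.l_neg)
    qed (auto simp: direct_sum_def M.a_ac N.a_ac)
  qed (auto simp: direct_sum_def M.smult_l_distr N.smult_l_distr M.smult_r_distr N.smult_r_distr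
      M.smult_assoc1 N.smult_assoc1)
qed

lemma direct_sum_hom:
  assumes "module R P" "f \<in> module_hom R M P" "g \<in> module_hom R N P"
  shows "(\<lambda>p. f (fst p) \<oplus>\<^bsub>P\<^esub> g (snd p)) \<in> module_hom R (direct_sum M N) P"
proof -
  interpret module R P by fact
  note f = module_homD[OF assms(2)] and g = module_homD[OF assms(3)]
  show ?thesis
    by (rule module_homI)
      (auto simp: direct_sum_def f g M.a_ac smult_r_distr)
qed

lemma direct_sum_inl_hom:
  assumes "module R M" "module R N"
  shows "(\<lambda>x. (x, \<zero>\<^bsub>N\<^esub>)) \<in> module_hom R M (direct_sum M N)"
proof -
  interpret N: module R N by fact
  show ?thesis by (rule module_homI) (auto simp: direct_sum_def)
qed

section \<open>Functoriality of tensor products\<close>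

text \<open>The map of free modules that lies over h \<otimes> f. With the identity for
  \<open>h\<close> it is the map \<open>push\<close> inside \<open>tensor_map\<close>.\<close>

definition tensor_push :: "('a, 'r) ring_scheme \<Rightarrow> ('a, 's) module \<Rightarrow> ('a, 'm) module \<Rightarrow>
    ('t \<Rightarrow> 's) \<Rightarrow> ('n \<Rightarrow> 'm) \<Rightarrow> ('t \<times> 'n \<Rightarrow> 'a) \<Rightarrow> ('s \<times> 'm \<Rightarrow> 'a)" where
  "tensor_push R S M h f = free_ext R (free_module R (carrier S \<times> carrier M))
     (\<lambda>z. basis_elt R (h (fst z), f (snd z)))"

lemma tensor_push_basis_funcset:
  assumes "cring R" "h \<in> carrier T \<rightarrow> carrier S" "f \<in> carrier N \<rightarrow> carrier M"
  shows "(\<lambda>z. basis_elt R (h (fst z), f (snd z)))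
    \<in> carrier T \<times> carrier N \<rightarrow> carrier (free_module R (carrier S \<times> carrier M))"
  using assms(2,3) by (auto intro!: basis_elt_closed[OF assms(1)])

lemma tensor_push_hom:
  assumes "cring R" "h \<in> carrier T \<rightarrow> carrier S" "f \<in> carrier N \<rightarrow> carrier M"
  shows "tensor_push R S M h f \<in> module_hom R (free_module R (carrier T \<times> carrier N))
    (free_module R (carrier S \<times> carrier M))"
  unfolding tensor_push_def
  by (intro free_ext_hom module_free_module tensor_push_basis_funcset assms)

lemma tensor_push_basis:
  assumes "cring R" "h \<in> carrier T \<rightarrow> carrier S" "f \<in> carrier N \<rightarrow> carrier M"
    and "t \<in> carrier T" "x \<in> carrier N"
  shows "tensor_push R S M h f (basis_elt R (t, x)) = basis_elt R (h t, f x)"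
  unfolding tensor_push_def
  using free_ext_basis[OF module_free_module[OF assms(1)] tensor_push_basis_funcset[OF assms(1-3)],
      of "(t, x)"] assms(4,5) by simp

text \<open>Both sides are linear in \<open>p\<close>, so moving the outer map inside the linear
  extension leaves only a comparison on basis elements. It is used to interchange h \<otimes> id
  with id \<otimes> f.\<close>

lemma tensor_push_comp:
  assumes "cring R" "h \<in> carrier T \<rightarrow> carrier S" "f \<in> carrier N \<rightarrow> carrier M"
    and "h' \<in> carrier S \<rightarrow> carrier S'" "f' \<in> carrier M \<rightarrow> carrier M'"
    and "p \<in> carrier (free_module R (carrier T \<times> carrier N))"
  shows "tensor_push R S' M' h' f' (tensor_push R S M h f p)
    = tensor_push R S' M' (\<lambda>t. h' (h t)) (\<lambda>x. f' (f x)) p"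
proof -
  let ?F = "free_module R (carrier S' \<times> carrier M')"
  interpret F: module R ?F by (rule module_free_module[OF assms(1)])
  have p: "p z \<in> carrier R" "p z \<noteq> \<zero>\<^bsub>R\<^esub> \<Longrightarrow> z \<in> carrier T \<times> carrier N" for z
    using assms(6) free_module_support[OF assms(6)]
    by (auto simp: free_module_def simp del: split_paired_All)
  have "tensor_push R S' M' h' f' (tensor_push R S M h f p) =
      free_ext R ?F (\<lambda>z. tensor_push R S' M' h' f' (basis_elt R (h (fst z), f (snd z)))) p"
    unfolding tensor_push_def[of R S M]
    by (intro module_hom_free_ext[OF _ _ tensor_push_hom _ assms(6)] module_free_module
        tensor_push_basis_funcset assms)
  also have "\<dots> = tensor_push R S' M' (\<lambda>t. h' (h t)) (\<lambda>x. f' (f x)) p"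
    unfolding tensor_push_def[of R S' M' "\<lambda>t. h' (h t)"] free_ext_def
  proof (rule F.finsum_cong')
    fix z assume "z \<in> {z. p z \<noteq> \<zero>\<^bsub>R\<^esub>}"
    then have "fst z \<in> carrier T" "snd z \<in> carrier N" using p(2)[of z] by auto
    then show "p z \<odot>\<^bsub>?F\<^esub> tensor_push R S' M' h' f' (basis_elt R (h (fst z), f (snd z)))
        = p z \<odot>\<^bsub>?F\<^esub> basis_elt R (h' (h (fst z)), f' (f (snd z)))"
      using assms(2-5) by (subst tensor_push_basis[OF assms(1,4,5)]) auto
  next
    show "(\<lambda>z. p z \<odot>\<^bsub>?F\<^esub> basis_elt R (h' (h (fst z)), f' (f (snd z))))
        \<in> {z. p z \<noteq> \<zero>\<^bsub>R\<^esub>} \<rightarrow> carrier ?F"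
      using p assms(2-5)
      by (intro Pi_I F.smult_closed basis_elt_closed[OF assms(1)]) fastforce+
  qed simp
  finally show ?thesis .
qed

section \<open>The bilinearity relations and the submodule they generate\<close>

lemma tensor_relations_closed:
  assumes "module R S" "module R M"
  shows "tensor_relations R S M \<subseteq> carrier (free_module R (carrier S \<times> carrier M))"
proof -
  interpret S: module R S by fact
  interpret M: module R M by fact
  let ?F = "free_module R (carrier S \<times> carrier M)"
  interpret F: module R ?F by (rule module_free_module) (rule S.R.is_cring)
  have d: "basis_elt R (s, x) \<in> carrier ?F" if "s \<in> carrier S" "x \<in> carrier M" for s x
    using that by (auto intro!: basis_elt_closed S.R.is_cring)
  show ?thesis
    unfolding tensor_relations_def Let_def by (auto simp: d)
qed

text \<open>Each of the four kinds of relation goes to the relation of the same kind between the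
  images under \<open>h\<close> and \<open>f\<close>, because these maps respect addition and scalar
  multiplication.\<close>

lemma tensor_push_relations:
  assumes "module R T" "module R S" "module R N" "module R M"
    and h: "h \<in> module_hom R T S" and f: "f \<in> module_hom R N M"
  shows "tensor_push R S M h f ` tensor_relations R T N \<subseteq> tensor_relations R S M"
proof -
  interpret T: module R T by fact
  interpret N: module R N by fact
  let ?F = "free_module R (carrier T \<times> carrier N)"
  let ?G = "free_module R (carrier S \<times> carrier M)"
  let ?P = "tensor_push R S M h f"
  note R = T.R.is_cring
  note F = module_free_module[OF R, of "carrier T \<times> carrier N"]
  note G = module_free_module[OF R, of "carrier S \<times> carrier M"]
  interpret F: module R ?F by (rule F)
  have hf: "h \<in> carrier T \<rightarrow> carrier S" "f \<in> carrier N \<rightarrow> carrier M"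
    using h f by (auto simp: module_hom_def)
  note P = tensor_push_hom[OF R hf]
  note P_simps = module_homD(2,3)[OF P] module_hom_diff[OF F G P] tensor_push_basis[OF R hf]
  have d: "basis_elt R (s, x) \<in> carrier ?F" if "s \<in> carrier T" "x \<in> carrier N" for s x
    using that by (auto intro!: basis_elt_closed R)
  show ?thesis
    unfolding tensor_relations_def Let_def image_Un
  proof (intro Un_mono; safe)
    fix s s' x assume s: "s \<in> carrier T" "s' \<in> carrier T" "x \<in> carrier N"
    then show "\<exists>t t' y. ?P (basis_elt R (s \<oplus>\<^bsub>T\<^esub> s', x)
        \<ominus>\<^bsub>?F\<^esub> (basis_elt R (s, x) \<oplus>\<^bsub>?F\<^esub> basis_elt R (s', x)))
      = basis_elt R (t \<oplus>\<^bsub>S\<^esub> t', y) \<ominus>\<^bsub>?G\<^esub> (basis_elt R (t, y) \<oplus>\<^bsub>?G\<^esub> basis_elt R (t', y))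
        \<and> t \<in> carrier S \<and> t' \<in> carrier S \<and> y \<in> carrier M"
      by (intro exI[of _ "h s"] exI[of _ "h s'"] exI[of _ "f x"])
        (simp add: d P_simps module_homD[OF h] module_homD[OF f])
  next
    fix s x x' assume s: "s \<in> carrier T" "x \<in> carrier N" "x' \<in> carrier N"
    then show "\<exists>t y y'. ?P (basis_elt R (s, x \<oplus>\<^bsub>N\<^esub> x')
        \<ominus>\<^bsub>?F\<^esub> (basis_elt R (s, x) \<oplus>\<^bsub>?F\<^esub> basis_elt R (s, x')))
      = basis_elt R (t, y \<oplus>\<^bsub>M\<^esub> y') \<ominus>\<^bsub>?G\<^esub> (basis_elt R (t, y) \<oplus>\<^bsub>?G\<^esub> basis_elt R (t, y'))
        \<and> t \<in> carrier S \<and> y \<in> carrier M \<and> y' \<in> carrier M"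
      by (intro exI[of _ "h s"] exI[of _ "f x"] exI[of _ "f x'"])
        (simp add: d P_simps module_homD[OF h] module_homD[OF f])
  next
    fix a s x assume s: "a \<in> carrier R" "s \<in> carrier T" "x \<in> carrier N"
    then show "\<exists>b t y. ?P (basis_elt R (a \<odot>\<^bsub>T\<^esub> s, x) \<ominus>\<^bsub>?F\<^esub> a \<odot>\<^bsub>?F\<^esub> basis_elt R (s, x))
      = basis_elt R (b \<odot>\<^bsub>S\<^esub> t, y) \<ominus>\<^bsub>?G\<^esub> b \<odot>\<^bsub>?G\<^esub> basis_elt R (t, y)
        \<and> b \<in> carrier R \<and> t \<in> carrier S \<and> y \<in> carrier M"
      by (intro exI[of _ a] exI[of _ "h s"] exI[of _ "f x"])
        (simp add: d P_simps module_homD[OF h] module_homD[OF f])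
    from s show "\<exists>b t y. ?P (basis_elt R (s, a \<odot>\<^bsub>N\<^esub> x) \<ominus>\<^bsub>?F\<^esub> a \<odot>\<^bsub>?F\<^esub> basis_elt R (s, x))
      = basis_elt R (t, b \<odot>\<^bsub>M\<^esub> y) \<ominus>\<^bsub>?G\<^esub> b \<odot>\<^bsub>?G\<^esub> basis_elt R (t, y)
        \<and> b \<in> carrier R \<and> t \<in> carrier S \<and> y \<in> carrier M"
      by (intro exI[of _ a] exI[of _ "h s"] exI[of _ "f x"])
        (simp add: d P_simps module_homD[OF h] module_homD[OF f])
  qed
qed

lemma submodule_tensor_kernel:
  assumes "module R S" "module R M"
  shows "submodule (tensor_kernel R S M) R (free_module R (carrier S \<times> carrier M))"
proof -
  interpret S: module R S by fact
  show ?thesis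
    unfolding tensor_kernel_def
    by (intro submodule_submodule_gen module_free_module tensor_relations_closed assms S.R.is_cring)
qed

text \<open>This makes h \<otimes> f well defined on tensor products; it is enough to check the
  generating relations.\<close>

lemma tensor_push_kernel:
  assumes "module R T" "module R S" "module R N" "module R M"
    and "h \<in> module_hom R T S" "f \<in> module_hom R N M"
    and "p \<in> tensor_kernel R T N"
  shows "tensor_push R S M h f p \<in> tensor_kernel R S M"
proof -
  interpret T: module R T by fact
  have hf: "h \<in> carrier T \<rightarrow> carrier S" "f \<in> carrier N \<rightarrow> carrier M"
    using assms(5,6) by (auto simp: module_hom_def)
  note R = T.R.is_cring
  have "tensor_push R S M h f ` tensor_relations R T N \<subseteq> tensor_kernel R S M"
    unfolding tensor_kernel_def
    by (rule order_trans[OF tensor_push_relations[OF assms(1-6)] submodule_gen_incl])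
  then show ?thesis
    using submodule_gen_hom_image[OF module_free_module[OF R] module_free_module[OF R]
        tensor_push_hom[OF R hf] submodule_tensor_kernel[OF assms(2,4)]
        tensor_relations_closed[OF assms(1,3)] _ assms(7)[unfolded tensor_kernel_def]]
    by simp
qed

section \<open>Transport of membership in the image of id \<otimes> f, and of module
  closures\<close>

lemma tensor_map_eq_push:
  "tensor_map R S N M f X =
    {tensor_push R S M (\<lambda>s. s) f p \<oplus>\<^bsub>free_module R (carrier S \<times> carrier M)\<^esub> k
      | p k. p \<in> X \<and> k \<in> tensor_kernel R S M}"
  by (simp add: tensor_map_def tensor_push_def free_ext_def Let_def)

text \<open>Since (h \<otimes> id)(id \<otimes> f) = (id \<otimes> f)(h \<otimes> id), applying h
  \<otimes> id to a preimage of s \<otimes> u under id \<otimes> f gives a preimage of h(s)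
  \<otimes> u. The argument is carried out on representatives in the free modules.\<close>

lemma tensor_elt_mem_image_hom:
  assumes "module R S" "module R S'" "module R M" "module R N"
    and f: "f \<in> module_hom R N M" and h: "h \<in> module_hom R S S'"
    and s: "s \<in> carrier S" and u: "u \<in> carrier M"
    and mem: "tensor_elt R S M s u \<in> tensor_map R S N M f ` carrier (tensor_product R S N)"
  shows "tensor_elt R S' M (h s) u \<in> tensor_map R S' N M f ` carrier (tensor_product R S' N)"
proof -
  interpret S: module R S by fact
  interpret S': module R S' by fact
  note R = S.R.is_cring
  let ?F = "\<lambda>S M. free_module R (carrier S \<times> carrier M)"
  have mod: "module R (free_module R X)" for X :: "'y set" by (rule module_free_module[OF R])
  interpret FM: module R "?F S M" by (rule module_free_module[OF R])
  interpret FN: module R "?F S N" by (rule module_free_module[OF R])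
  interpret FM': module R "?F S' M" by (rule module_free_module[OF R])
  interpret FN': module R "?F S' N" by (rule module_free_module[OF R])
  note KM = submodule_tensor_kernel[OF assms(1,3)]
  note KN = submodule_tensor_kernel[OF assms(1,4)]
  note KM' = submodule_tensor_kernel[OF assms(2,3)]
  note KN' = submodule_tensor_kernel[OF assms(2,4)]
  have id: "(\<lambda>x. x) \<in> module_hom R A A" for A :: "('a, 'y) module" by (simp add: module_hom_def)
  have pi: "h \<in> carrier S \<rightarrow> carrier S'" "f \<in> carrier N \<rightarrow> carrier M"
    using h f by (auto simp: module_hom_def)
  \<comment> \<open>The four sides of the square: \<open>?a\<close> and \<open>?e\<close> lift id
    \<otimes> f over \<open>S\<close> and over \<open>S'\<close>, while \<open>?b\<close> and
    \<open>?c\<close> lift h \<otimes> id over \<open>M\<close> and over \<open>N\<close>.\<close>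
  let ?a = "tensor_push R S M (\<lambda>s. s) f" and ?b = "tensor_push R S' M h (\<lambda>x. x)"
  let ?c = "tensor_push R S' N h (\<lambda>x. x)" and ?e = "tensor_push R S' M (\<lambda>s. s) f"
  have a: "?a \<in> module_hom R (?F S N) (?F S M)" and b: "?b \<in> module_hom R (?F S M) (?F S' M)"
    and c: "?c \<in> module_hom R (?F S N) (?F S' N)" and e: "?e \<in> module_hom R (?F S' N) (?F S' M)"
    using pi by (auto intro!: tensor_push_hom R)
  define d where "d = basis_elt R (s, u)"
  define d' where "d' = basis_elt R (h s, u)"
  have d: "d \<in> carrier (?F S M)" unfolding d_def using s u by (intro basis_elt_closed R) auto
  have d': "d' \<in> carrier (?F S' M)"
    unfolding d'_def using s u pi by (intro basis_elt_closed R) auto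
  have bd: "?b d = d'" unfolding d_def d'_def
    using tensor_push_basis[OF R, of h S S' "\<lambda>x. x" M M s u] pi s u by auto
  obtain X where X: "X \<in> carrier (tensor_product R S N)"
    "tensor_kernel R S M +>\<^bsub>?F S M\<^esub> d = tensor_map R S N M f X"
    using mem by (auto simp: tensor_elt_def d_def)
  \<comment> \<open>A coset contains its representative, so equality of the two cosets yields an
    actual equation between \<open>d\<close>, the image of some \<open>p\<close> in
    \<open>X\<close>, and an error term \<open>k\<close> in the kernel.\<close>
  have "d \<in> tensor_kernel R S M +>\<^bsub>?F S M\<^esub> d"
    by (rule abelian_subgroup.a_rcos_self[OF abelian_subgroup_submodule[OF FM.module_axioms KM] d])
  then obtain p k where pk: "p \<in> X" "k \<in> tensor_kernel R S M" "d = ?a p \<oplus>\<^bsub>?F S M\<^esub> k"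
    unfolding X(2) tensor_map_eq_push by auto
  have p: "p \<in> carrier (?F S N)"
    using X(1) pk(1) abelian_subgroup.a_rcosets_carrier[OF
        abelian_subgroup_submodule[OF FN.module_axioms KN]]
    by (auto simp: tensor_product_def quotient_module_def)
  have k: "k \<in> carrier (?F S M)" using pk(2) FM.submoduleE(1)[OF KM] by auto
  let ?q = "?c p" and ?k = "?b k"
  have q: "?q \<in> carrier (?F S' N)" using p by (rule module_homD(1)[OF c])
  have kK: "?k \<in> tensor_kernel R S' M"
    by (rule tensor_push_kernel[OF assms(1,2,3,3) h id pk(2)])
  \<comment> \<open>The square commutes: both composites are the push along \<open>h\<close> and
    \<open>f\<close> simultaneously.\<close>
  have eq: "?e ?q = ?b (?a p)"
    using pi tensor_push_comp[OF R _ _ _ _ p, of h S' "\<lambda>x. x" N "\<lambda>x. x" S' f M]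
      tensor_push_comp[OF R _ _ _ _ p, of "\<lambda>x. x" S f M h S' "\<lambda>x. x" M] by simp
  have de: "d' = ?e ?q \<oplus>\<^bsub>?F S' M\<^esub> ?k"
    unfolding eq bd[symmetric] pk(3) using p k module_homD(1)[OF a]
    by (intro module_homD(2)[OF b])
  have eq_closed: "?e ?q \<in> carrier (?F S' M)" using q by (rule module_homD(1)[OF e])
  note K'_sub = FM'.submoduleE(1)[OF KM', THEN subsetD]
  have e0: "?e \<zero>\<^bsub>?F S' N\<^esub> = \<zero>\<^bsub>?F S' M\<^esub>"
    by (rule module_hom_zero[OF FN'.module_axioms FM'.module_axioms e])
  \<comment> \<open>The coset of \<open>?q\<close> is the desired preimage. Its image is compared
    with the coset of \<open>d'\<close> by absorbing \<open>?k\<close>, and the images of kernel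
    elements, into the kernel.\<close>
  have "tensor_elt R S' M (h s) u = tensor_map R S' N M f (tensor_kernel R S' N +>\<^bsub>?F S' N\<^esub> ?q)"
    unfolding tensor_elt_def tensor_map_eq_push d'_def[symmetric]
  proof (intro equalityI subsetI)
    fix y assume "y \<in> tensor_kernel R S' M +>\<^bsub>?F S' M\<^esub> d'"
    then obtain l where l: "l \<in> tensor_kernel R S' M" "y = l \<oplus>\<^bsub>?F S' M\<^esub> d'"
      by (auto simp: a_r_coset_def')
    have "y = ?e ?q \<oplus>\<^bsub>?F S' M\<^esub> (l \<oplus>\<^bsub>?F S' M\<^esub> ?k)"
      unfolding l(2) de using K'_sub[OF l(1)] K'_sub[OF kK] eq_closed
      by (intro FM'.a_lcomm)
    moreover have "l \<oplus>\<^bsub>?F S' M\<^esub> ?k \<in> tensor_kernel R S' M"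
      using FM'.submoduleE(5)[OF KM' l(1) kK] .
    moreover have "?q \<in> tensor_kernel R S' N +>\<^bsub>?F S' N\<^esub> ?q"
      by (rule abelian_subgroup.a_rcos_self[OF abelian_subgroup_submodule[OF FN'.module_axioms KN'] q])
    ultimately show "y \<in> {?e p \<oplus>\<^bsub>?F S' M\<^esub> k | p k.
        p \<in> tensor_kernel R S' N +>\<^bsub>?F S' N\<^esub> ?q \<and> k \<in> tensor_kernel R S' M}"
      by blast
  next
    fix y assume "y \<in> {?e p \<oplus>\<^bsub>?F S' M\<^esub> k | p k.
        p \<in> tensor_kernel R S' N +>\<^bsub>?F S' N\<^esub> ?q \<and> k \<in> tensor_kernel R S' M}"
    then obtain n l where nl: "n \<in> tensor_kernel R S' N" "l \<in> tensor_kernel R S' M"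
      "y = ?e (n \<oplus>\<^bsub>?F S' N\<^esub> ?q) \<oplus>\<^bsub>?F S' M\<^esub> l"
      by (auto simp: a_r_coset_def')
    have n: "n \<in> carrier (?F S' N)" using nl(1) FN'.submoduleE(1)[OF KN'] by auto
    have en: "?e n \<in> tensor_kernel R S' M"
      by (rule tensor_push_kernel[OF assms(2,2,4,3) id f nl(1)])
    \<comment> \<open>Solved from \<open>de\<close>: the image of \<open>?q\<close> is
      \<open>d'\<close> minus \<open>?k\<close>, so \<open>-?k\<close> joins the other kernel
      terms.\<close>
    let ?l = "(?e n \<oplus>\<^bsub>?F S' M\<^esub> l) \<oplus>\<^bsub>?F S' M\<^esub> (\<ominus>\<^bsub>?F S' M\<^esub> ?k)"
    have "?l \<in> tensor_kernel R S' M"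
      by (intro FM'.submoduleE(3,5)[OF KM'] en nl(2) kK)
    moreover have "y = ?l \<oplus>\<^bsub>?F S' M\<^esub> d'"
    proof -
      have "y = (?e n \<oplus>\<^bsub>?F S' M\<^esub> l) \<oplus>\<^bsub>?F S' M\<^esub> ?e ?q"
        unfolding nl(3) module_homD(2)[OF e n q]
        using K'_sub[OF nl(2)] K'_sub[OF en] eq_closed by (simp add: FM'.a_ac)
      moreover have "?e ?q = (\<ominus>\<^bsub>?F S' M\<^esub> ?k) \<oplus>\<^bsub>?F S' M\<^esub> d'"
        unfolding de using K'_sub[OF kK] eq_closed by (simp add: FM'.a_comm FM'.r_neg2 FM'.r_neg1)
      ultimately show ?thesis
        using K'_sub[OF nl(2)] K'_sub[OF en] K'_sub[OF kK] d' by (simp add: FM'.a_assoc)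
    qed
    ultimately show "y \<in> tensor_kernel R S' M +>\<^bsub>?F S' M\<^esub> d'"
      by (auto simp: a_r_coset_def')
  qed
  moreover have "tensor_kernel R S' N +>\<^bsub>?F S' N\<^esub> ?q \<in> carrier (tensor_product R S' N)"
    unfolding tensor_product_def
    by (rule module_homD(1)[OF quotient_map_hom[OF FN'.module_axioms KN'] q])
  ultimately show ?thesis by auto
qed

text \<open>Only the membership condition for the single tensor s \<otimes> u is used: h \<otimes>
  id carries it to h(s) \<otimes> u, and h(s) can be made any element of \<open>S'\<close>.\<close>

lemma closure_le_if_homs:
  assumes "module R S" "module R S'" "s \<in> carrier S"
    and homs: "\<And>s'. s' \<in> carrier S' \<Longrightarrow> \<exists>h\<in>module_hom R S S'. h s = s'"
  shows "closure_le R (module_closure R S) (module_closure R S')"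
  unfolding closure_le_def
proof (intro allI impI subsetI)
  fix M N u
  assume MN: "module R M \<and> fin_gen R M \<and> submodule N R M \<and> fin_gen R (M\<lparr>carrier := N\<rparr>)"
    and u: "u \<in> module_closure R S M N"
  interpret M: module R M using MN by blast
  have N: "module R (M\<lparr>carrier := N\<rparr>)"
    using submodule.submodule_is_module[OF _ M.module_axioms] MN by blast
  have incl: "(\<lambda>x. x) \<in> module_hom R (M\<lparr>carrier := N\<rparr>) M"
    using M.submoduleE(1)[of N] MN by (auto simp: module_hom_def)
  have uM: "u \<in> carrier M"
    and mem: "tensor_elt R S M s u \<in> tensor_map R S (M\<lparr>carrier := N\<rparr>) M (\<lambda>x. x) `
      carrier (tensor_product R S (M\<lparr>carrier := N\<rparr>))"
    using u assms(3) by (auto simp: module_closure_def Let_def)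
  have "tensor_elt R S' M s' u \<in> tensor_map R S' (M\<lparr>carrier := N\<rparr>) M (\<lambda>x. x) `
      carrier (tensor_product R S' (M\<lparr>carrier := N\<rparr>))" if s': "s' \<in> carrier S'" for s'
  proof -
    obtain h where h: "h \<in> module_hom R S S'" "h s = s'" using homs[OF s'] by blast
    show ?thesis
      using tensor_elt_mem_image_hom[OF assms(1,2) M.module_axioms N incl h(1) assms(3) uM mem]
      by (simp add: h(2))
  qed
  then show "u \<in> module_closure R S' M N"
    using uM by (auto simp: module_closure_def Let_def)
qed

section \<open>Extending homomorphisms along modifications\<close>

text \<open>For I = (x_1, ..., x_n) the product IM is x_1 M + ... + x_n M. The sums on the right
  form a submodule \<open>H\<close>, and the scalars that carry \<open>M\<close> into
  \<open>H\<close> form an ideal containing every x_i, hence containing I.\<close>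

lemma ideal_times_module_representation:
  assumes M: "module R M" and xs: "set xs \<subseteq> carrier R"
    and y: "y \<in> ideal_times_module R (Idl\<^bsub>R\<^esub> (set xs)) M"
  obtains b where "b \<in> {..<length xs} \<rightarrow> carrier M"
    "y = (\<Oplus>\<^bsub>M\<^esub>j\<in>{..<length xs}. xs ! j \<odot>\<^bsub>M\<^esub> b j)"
proof -
  interpret module R M by fact
  let ?S = "\<lambda>b. \<Oplus>\<^bsub>M\<^esub>j\<in>{..<length xs}. xs ! j \<odot>\<^bsub>M\<^esub> b j"
  let ?B = "{..<length xs} \<rightarrow> carrier M"
  define H where "H = ?S ` ?B"
  have xj: "xs ! j \<in> carrier R" if "j < length xs" for j using xs that by auto
  have "submodule H R M"
  proof (rule submoduleI)
    show "H \<subseteq> carrier M" unfolding H_def using xj by (auto intro!: M.finsum_closed)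
    have "\<zero>\<^bsub>M\<^esub> = ?S (\<lambda>_. \<zero>\<^bsub>M\<^esub>)"
      using xj by (intro M.add.finprod_one_eqI[symmetric]) auto
    then show "\<zero>\<^bsub>M\<^esub> \<in> H"
      unfolding H_def by (rule image_eqI[where x = "\<lambda>_. \<zero>\<^bsub>M\<^esub>"]) auto
    have add: "?S b \<oplus>\<^bsub>M\<^esub> ?S c = ?S (\<lambda>j. b j \<oplus>\<^bsub>M\<^esub> c j)" if "b \<in> ?B" "c \<in> ?B" for b c
    proof -
      have "?S b \<oplus>\<^bsub>M\<^esub> ?S c
          = (\<Oplus>\<^bsub>M\<^esub>j\<in>{..<length xs}. xs ! j \<odot>\<^bsub>M\<^esub> b j \<oplus>\<^bsub>M\<^esub> xs ! j \<odot>\<^bsub>M\<^esub> c j)"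
        using that xj by (intro M.finsum_addf[symmetric]) auto
      also have "\<dots> = ?S (\<lambda>j. b j \<oplus>\<^bsub>M\<^esub> c j)"
        using that xj by (intro M.finsum_cong') (auto simp: smult_r_distr Pi_iff)
      finally show ?thesis .
    qed
    show "x \<oplus>\<^bsub>M\<^esub> y \<in> H" if xy: "x \<in> H" "y \<in> H" for x y
    proof -
      obtain b c where bc: "x = ?S b" "b \<in> ?B" "y = ?S c" "c \<in> ?B"
        using xy unfolding H_def by (elim imageE)
      have "(\<lambda>j. b j \<oplus>\<^bsub>M\<^esub> c j) \<in> ?B" using bc(2,4) by auto
      then show ?thesis
        unfolding bc(1,3) add[OF bc(2,4)] unfolding H_def by (rule imageI)
    qed
    show smult: "a \<odot>\<^bsub>M\<^esub> x \<in> H" if a: "a \<in> carrier R" and x: "x \<in> H" for a x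
    proof -
      obtain b where b: "x = ?S b" "b \<in> ?B" using x unfolding H_def by (rule imageE)
      have "a \<odot>\<^bsub>M\<^esub> x = (\<Oplus>\<^bsub>M\<^esub>j\<in>{..<length xs}. a \<odot>\<^bsub>M\<^esub> (xs ! j \<odot>\<^bsub>M\<^esub> b j))"
        unfolding b(1) using b(2) xj a by (intro finsum_smult_ldistr) auto
      also have "\<dots> = ?S (\<lambda>j. a \<odot>\<^bsub>M\<^esub> b j)"
        using a b(2) xj
        by (intro M.finsum_cong') (auto simp: smult_assoc1[symmetric] R.m_comm Pi_iff)
      also have "\<dots> \<in> H" unfolding H_def using a b(2) by (intro imageI) auto
      finally show ?thesis .
    qed
    show "\<ominus>\<^bsub>M\<^esub> x \<in> H" if x: "x \<in> H" for x
    proof -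
      have "x \<in> carrier M" using x unfolding H_def using xj by (auto intro!: M.finsum_closed)
      then have "\<ominus>\<^bsub>M\<^esub> x = (\<ominus>\<^bsub>R\<^esub> \<one>\<^bsub>R\<^esub>) \<odot>\<^bsub>M\<^esub> x" by (simp add: smult_l_minus)
      then show ?thesis using smult[OF _ x, of "\<ominus>\<^bsub>R\<^esub> \<one>\<^bsub>R\<^esub>"] by simp
    qed
  qed
  note H = this
  note E = submoduleE[OF this]
  \<comment> \<open>The colon ideal of \<open>H\<close> and \<open>M\<close>. Minimality of the
    generated ideal then applies, and its elements need not be written as combinations of
    \<open>xs\<close>.\<close>
  let ?J = "{a \<in> carrier R. \<forall>x\<in>carrier M. a \<odot>\<^bsub>M\<^esub> x \<in> H}"
  have "ideal ?J R"
  proof (rule idealI)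
    show "ring R" by (rule R.ring_axioms)
    show "subgroup ?J (add_monoid R)"
      by (rule R.add.subgroupI)
        (auto simp: smult_l_distr smult_l_minus E submodule_zero[OF H] a_inv_def[symmetric]
          intro!: exI[of _ "\<zero>\<^bsub>R\<^esub>"])
  qed (auto simp: smult_assoc1 R.m_comm E)
  moreover have "set xs \<subseteq> ?J"
  proof
    fix a assume "a \<in> set xs"
    then obtain i where i: "i < length xs" "a = xs ! i" by (auto simp: in_set_conv_nth)
    have "a \<odot>\<^bsub>M\<^esub> x \<in> H" if x: "x \<in> carrier M" for x
    proof -
      \<comment> \<open>The coefficient family concentrated at \<open>i\<close> exhibits the product
        of \<open>xs ! i\<close> and \<open>x\<close> as an element of \<open>H\<close>.\<close>
      have "?S (\<lambda>j. if i = j then x else \<zero>\<^bsub>M\<^esub>)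
          = (\<Oplus>\<^bsub>M\<^esub>j\<in>{..<length xs}. if i = j then xs ! j \<odot>\<^bsub>M\<^esub> x else \<zero>\<^bsub>M\<^esub>)"
        using x xj by (intro M.finsum_cong') auto
      also have "\<dots> = xs ! i \<odot>\<^bsub>M\<^esub> x"
        using i x xj by (intro M.add.finprod_singleton) auto
      finally show ?thesis
        unfolding H_def i(2) by (intro image_eqI[of _ _ "\<lambda>j. if i = j then x else \<zero>\<^bsub>M\<^esub>"]) (use x in auto)
    qed
    then show "a \<in> ?J" using i xj by auto
  qed
  ultimately have "Idl\<^bsub>R\<^esub> (set xs) \<subseteq> ?J" by (rule R.genideal_minimal)
  then have "ideal_times_module R (Idl\<^bsub>R\<^esub> (set xs)) M \<subseteq> H"
    unfolding ideal_times_module_def by (intro submodule_gen_least[OF H]) auto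
  then show ?thesis using y that unfolding H_def by blast
qed

lemma submodule_ideal_times_module:
  assumes "module R M" "I \<subseteq> carrier R"
  shows "submodule (ideal_times_module R I M) R M"
proof -
  interpret module R M by fact
  show ?thesis unfolding ideal_times_module_def
    by (rule submodule_submodule_gen[OF assms(1)]) (use assms(2) in auto)
qed

text \<open>Membership in the ring is part of \<open>regular_sequence\<close>, so it can be read off
  from any completion to a full system of parameters.\<close>

lemma big_CM_module_params_closed:
  assumes "big_CM_module R B" "part_of_system_of_parameters R xs"
  shows "set xs \<subseteq> carrier R"
proof -
  obtain ys where "system_of_parameters R (xs @ ys)"
    using assms(2) by (auto simp: part_of_system_of_parameters_def)
  then show ?thesis
    using assms(1) unfolding big_CM_module_def regular_sequence_def by fastforce
qed

text \<open>The relation says that x annihilates the class of v modulo (xs)B. As the next entry of a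
  regular sequence, x is a nonzerodivisor on that quotient, so v lies in (xs)B and is a combination
  of \<open>xs\<close>. For empty \<open>xs\<close> this says v = 0.\<close>

lemma big_CM_module_param_relation:
  assumes B: "big_CM_module R B" and part: "part_of_system_of_parameters R (xs @ [x])"
    and v: "v \<in> carrier B" and w: "\<And>j. j < length xs \<Longrightarrow> w j \<in> carrier B"
    and rel: "x \<odot>\<^bsub>B\<^esub> v = (\<Oplus>\<^bsub>B\<^esub>j\<in>{..<length xs}. xs ! j \<odot>\<^bsub>B\<^esub> w j)"
  obtains b where "b \<in> {..<length xs} \<rightarrow> carrier B"
    "v = (\<Oplus>\<^bsub>B\<^esub>j\<in>{..<length xs}. xs ! j \<odot>\<^bsub>B\<^esub> b j)"
proof -
  interpret module R B using B by (simp add: big_CM_module_def)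
  obtain ys where "system_of_parameters R ((xs @ [x]) @ ys)"
    using part by (auto simp: part_of_system_of_parameters_def)
  then have reg: "regular_sequence R B ((xs @ [x]) @ ys)"
    using B by (simp add: big_CM_module_def)
  let ?H = "ideal_times_module R (Idl\<^bsub>R\<^esub> (set xs)) B"
  have carr: "set xs \<subseteq> carrier R" "x \<in> carrier R"
    using reg by (auto simp: regular_sequence_def)
  have "\<forall>i<length ((xs @ [x]) @ ys). nonzerodivisor_on (quotient_module B (ideal_times_module R
      (Idl\<^bsub>R\<^esub> (set (take i ((xs @ [x]) @ ys)))) B)) (((xs @ [x]) @ ys) ! i)"
    using reg unfolding regular_sequence_def by blast
  \<comment> \<open>In the completed list the entry at index \<open>length xs\<close> is
    \<open>x\<close>, and the entries before it are exactly \<open>xs\<close>.\<close>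
  from this[rule_format, of "length xs"]
  have nzd: "nonzerodivisor_on (quotient_module B ?H) x"
    by (simp add: nth_append)
  have "ideal (Idl\<^bsub>R\<^esub> (set xs)) R" by (rule R.genideal_ideal[OF carr(1)])
  then have "Idl\<^bsub>R\<^esub> (set xs) \<subseteq> carrier R"
    using additive_subgroup.a_subset ideal.axioms(1) by blast
  then have H: "submodule ?H R B" by (intro submodule_ideal_times_module module_axioms)
  interpret H: abelian_subgroup ?H B by (rule abelian_subgroup_submodule[OF module_axioms H])
  have "xs ! j \<odot>\<^bsub>B\<^esub> w j \<in> ?H" if "j < length xs" for j
    unfolding ideal_times_module_def using that w R.genideal_self[OF carr(1)]
    by (intro subsetD[OF submodule_gen_incl]) force
  then have "x \<odot>\<^bsub>B\<^esub> v \<in> ?H"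
    unfolding rel by (intro submodule_finsum[OF module_axioms H]) auto
  then have "x \<odot>\<^bsub>quotient_module B ?H\<^esub> (?H +>\<^bsub>B\<^esub> v) = \<zero>\<^bsub>quotient_module B ?H\<^esub>"
    by (simp add: quotient_module_smult_coset[OF module_axioms H carr(2) v] H.a_rcos_const)
      (simp add: quotient_module_def)
  moreover have "?H +>\<^bsub>B\<^esub> v \<in> carrier (quotient_module B ?H)"
    by (rule module_homD(1)[OF quotient_map_hom[OF module_axioms H] v])
  ultimately have "?H +>\<^bsub>B\<^esub> v = ?H"
    using nzd by (simp add: nonzerodivisor_on_def) (simp add: quotient_module_def)
  then have "v \<in> ?H" using H.a_rcos_self[OF v] by simp
  then show ?thesis
    using ideal_times_module_representation[OF module_axioms carr(1)] that by metis
qed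

section \<open>Parameter module modifications: structure and homomorphisms out of them\<close>

lemma module_modification_sum:
  assumes "module R M"
  shows "module R (modification_sum R M I c)"
proof -
  interpret module R M by fact
  show ?thesis
    unfolding modification_sum_def
    by (intro module_direct_sum module_free_module assms R.is_cring)
qed

lemma modification_relator_closed:
  assumes "module R M" "\<And>i. i \<in> I \<Longrightarrow> holds_param_relation R M (c i)"
    and params: "\<And>i. i \<in> I \<Longrightarrow> set (params (c i)) \<subseteq> carrier R"
  shows "modification_relator R c ` I \<subseteq> carrier (modification_sum R M I c)"
proof (rule image_subsetI)
  interpret module R M by fact
  fix i assume i: "i \<in> I"
  note h = assms(2)[OF i, unfolded holds_param_relation_def]
  have x: "params (c i) ! j \<in> carrier R" if "j < length (rhs_elts (c i))" for j
    using that h params[OF i] by (intro subsetD[OF params[OF i]] nth_mem) auto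
  let ?r = "\<lambda>(i', j). if i' = i \<and> j < length (rhs_elts (c i)) then params (c i) ! j else \<zero>\<^bsub>R\<^esub>"
  have "finite {z. ?r z \<noteq> \<zero>\<^bsub>R\<^esub>}"
    by (rule finite_subset[of _ "{i} \<times> {..<length (rhs_elts (c i))}"]) (auto split: if_splits)
  then show "modification_relator R c i \<in> carrier (modification_sum R M I c)"
    using h x i
    by (auto simp: modification_relator_def modification_sum_def direct_sum_def free_module_def)
qed

text \<open>On the direct sum, \<open>G\<close> is \<open>g\<close> on \<open>M\<close> and sends
  the generator (i, j) to \<open>b i j\<close>. Coefficients with x_1 b_1 + ... + x_k b_k = -g(u)
  make it vanish on every relator, so it descends to the quotient and then along the isomorphism to
  \<open>M'\<close>. Each member has its own generators, so the choices for different members do not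
  interfere.\<close>

lemma modification_extend_hom:
  assumes M: "module R M" and M': "module R M'" and mod: "is_modification R M I c \<phi> M'"
    and B: "big_CM_module R B" and g: "g \<in> module_hom R M B"
  obtains g' where "g' \<in> module_hom R M' B" "\<And>x. x \<in> carrier M \<Longrightarrow> g' (\<phi> x) = g x"
proof -
  interpret M: module R M by fact
  interpret B: module R B using B by (simp add: big_CM_module_def)
  have rel: "holds_param_relation R M (c i)" if "i \<in> I" for i
    using mod that by (simp add: is_modification_def)
  let ?k = "\<lambda>i. length (rhs_elts (c i))"
  have params: "set (params (c i)) \<subseteq> carrier R" if "i \<in> I" for i
    using rel[OF that] big_CM_module_params_closed[OF B] by (simp add: holds_param_relation_def)
  have x: "params (c i) ! j \<in> carrier R" if "i \<in> I" "j < Suc (?k i)" for i j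
    using that rel[OF that(1)] params[OF that(1)]
    by (auto simp: holds_param_relation_def intro!: subsetD[OF params[OF that(1)]])
  have "\<exists>b. b \<in> {..<?k i} \<rightarrow> carrier B \<and>
      \<ominus>\<^bsub>B\<^esub> g (lhs_elt (c i)) = (\<Oplus>\<^bsub>B\<^esub>j\<in>{..<?k i}. params (c i) ! j \<odot>\<^bsub>B\<^esub> b j)" if i: "i \<in> I" for i
  proof -
    note h = rel[OF i, unfolded holds_param_relation_def]
    let ?xs = "take (?k i) (params (c i))"
    let ?u = "lhs_elt (c i)" and ?us = "rhs_elts (c i)"
    have us: "?us ! j \<in> carrier M" if "j < ?k i" for j using that h by auto
    have u: "?u \<in> carrier M" using h by simp
    have len: "length ?xs = ?k i" using h by simp
    \<comment> \<open>There are k + 1 parameters, counted from 0, so index \<open>?k i\<close> holds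
      x_{k+1} and the initial segment \<open>?xs\<close> holds x_1, ..., x_k.\<close>
    have "?xs @ [params (c i) ! ?k i] = params (c i)"
      using h by (metis lessI take_Suc_conv_app_nth take_all_iff order_refl)
    then have part: "part_of_system_of_parameters R (?xs @ [params (c i) ! ?k i])"
      using h by simp
    \<comment> \<open>The defining relation is negated in \<open>M\<close> and then mapped by
      \<open>g\<close>, giving a relation in \<open>B\<close> with -g(u) on the left, the element
      that must be a combination of x_1, ..., x_k.\<close>
    have "params (c i) ! ?k i \<odot>\<^bsub>B\<^esub> (\<ominus>\<^bsub>B\<^esub> g ?u) = g (params (c i) ! ?k i \<odot>\<^bsub>M\<^esub> (\<ominus>\<^bsub>M\<^esub> ?u))"
      using u x[OF i] by (simp add: module_homD[OF g] module_hom_neg[OF M B.module_axioms g])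
    also have "params (c i) ! ?k i \<odot>\<^bsub>M\<^esub> (\<ominus>\<^bsub>M\<^esub> ?u)
        = (\<ominus>\<^bsub>R\<^esub> \<one>\<^bsub>R\<^esub>) \<odot>\<^bsub>M\<^esub> (\<Oplus>\<^bsub>M\<^esub>j\<in>{..<?k i}. params (c i) ! j \<odot>\<^bsub>M\<^esub> (?us ! j))"
      using u x[OF i] us h
      by (simp add: M.smult_r_minus M.smult_l_minus M.finsum_closed Pi_iff)
    also have "\<dots> = (\<Oplus>\<^bsub>M\<^esub>j\<in>{..<?k i}. (\<ominus>\<^bsub>R\<^esub> \<one>\<^bsub>R\<^esub>) \<odot>\<^bsub>M\<^esub> (params (c i) ! j \<odot>\<^bsub>M\<^esub> (?us ! j)))"
      using us x[OF i] by (intro M.finsum_smult_ldistr) auto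
    also have "\<dots> = (\<Oplus>\<^bsub>M\<^esub>j\<in>{..<?k i}. params (c i) ! j \<odot>\<^bsub>M\<^esub> (\<ominus>\<^bsub>M\<^esub> (?us ! j)))"
      using us x[OF i]
      by (intro M.finsum_cong') (auto simp: M.smult_r_minus M.smult_l_minus)
    also have "g \<dots> = (\<Oplus>\<^bsub>B\<^esub>j\<in>{..<?k i}. g (params (c i) ! j \<odot>\<^bsub>M\<^esub> (\<ominus>\<^bsub>M\<^esub> (?us ! j))))"
      using us x[OF i] by (intro module_hom_finsum[OF M B.module_axioms g]) auto
    also have "\<dots> = (\<Oplus>\<^bsub>B\<^esub>j\<in>{..<length ?xs}. ?xs ! j \<odot>\<^bsub>B\<^esub> g (\<ominus>\<^bsub>M\<^esub> (?us ! j)))"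
      using us x[OF i] unfolding len by (intro B.finsum_cong') (auto simp: module_homD[OF g])
    finally obtain b where b: "b \<in> {..<length ?xs} \<rightarrow> carrier B"
      "\<ominus>\<^bsub>B\<^esub> g ?u = (\<Oplus>\<^bsub>B\<^esub>j\<in>{..<length ?xs}. ?xs ! j \<odot>\<^bsub>B\<^esub> b j)"
      using u us len
      by (elim big_CM_module_param_relation[OF B part, rotated 2]) (auto simp: module_homD[OF g])
    have "(\<Oplus>\<^bsub>B\<^esub>j\<in>{..<length ?xs}. ?xs ! j \<odot>\<^bsub>B\<^esub> b j)
        = (\<Oplus>\<^bsub>B\<^esub>j\<in>{..<?k i}. params (c i) ! j \<odot>\<^bsub>B\<^esub> b j)"
      using b(1) x[OF i] unfolding len by (intro B.finsum_cong') auto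
    then show ?thesis using b len by auto
  qed
  \<comment> \<open>The coefficients for all members, possibly infinitely many, are chosen at
    once.\<close>
  then obtain b where b: "\<And>i. i \<in> I \<Longrightarrow> b i \<in> {..<?k i} \<rightarrow> carrier B"
    "\<And>i. i \<in> I \<Longrightarrow>
      \<ominus>\<^bsub>B\<^esub> g (lhs_elt (c i)) = (\<Oplus>\<^bsub>B\<^esub>j\<in>{..<?k i}. params (c i) ! j \<odot>\<^bsub>B\<^esub> b i j)"
    by metis
  let ?X = "{(i, j). i \<in> I \<and> j < ?k i}"
  let ?Q = "modification_sum R M I c"
  interpret Q: module R ?Q by (rule module_modification_sum[OF M])
  define e where "e = (\<lambda>(i, j). b i j)"
  have e: "e \<in> ?X \<rightarrow> carrier B" unfolding e_def using b(1) by auto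
  define G where "G = (\<lambda>q. g (fst q) \<oplus>\<^bsub>B\<^esub> free_ext R B e (snd q))"
  have G: "G \<in> module_hom R ?Q B"
    unfolding G_def modification_sum_def
    by (intro direct_sum_hom free_ext_hom B.module_axioms g e)
  note rels = modification_relator_closed[OF M rel params]
  have G0: "G z = \<zero>\<^bsub>B\<^esub>" if z: "z \<in> modification_relator R c ` I" for z
  proof -
    obtain i where i: "i \<in> I" "z = modification_relator R c i" using z by blast
    \<comment> \<open>The positions of the generators of member \<open>i\<close>. They contain the
      support of the relator, which is smaller when some parameter is zero.\<close>
    let ?A = "Pair i ` {..<?k i}"
    have r: "snd z \<in> carrier (free_module R ?X)"
      using subsetD[OF rels z] by (auto simp: modification_sum_def direct_sum_def)
    have "free_ext R B e (snd z) = (\<Oplus>\<^bsub>B\<^esub>y\<in>?A. snd z y \<odot>\<^bsub>B\<^esub> e y)"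
      by (rule free_ext_eq[OF B.module_axioms e r])
        (auto simp: i modification_relator_def split: if_splits)
    also have "\<dots> = (\<Oplus>\<^bsub>B\<^esub>j\<in>{..<?k i}. snd z (i, j) \<odot>\<^bsub>B\<^esub> e (i, j))"
      using x[OF i(1)] b(1)[OF i(1)]
      by (intro B.finsum_reindex) (auto simp: i modification_relator_def e_def inj_on_def Pi_iff)
    also have "\<dots> = (\<Oplus>\<^bsub>B\<^esub>j\<in>{..<?k i}. params (c i) ! j \<odot>\<^bsub>B\<^esub> b i j)"
      using x[OF i(1)] b(1)[OF i(1)]
      by (intro B.finsum_cong') (auto simp: i(2) modification_relator_def e_def Pi_iff)
    also have "\<dots> = \<ominus>\<^bsub>B\<^esub> g (lhs_elt (c i))" using b(2)[OF i(1)] by simp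
    finally show ?thesis
      using rel[OF i(1)] i(2)
      by (simp add: G_def modification_relator_def holds_param_relation_def B.r_neg module_homD[OF g])
  qed
  let ?K = "modification_kernel R M I c"
  have K: "submodule ?K R ?Q"
    unfolding modification_kernel_def by (rule submodule_submodule_gen[OF Q.module_axioms rels])
  obtain h where h: "h \<in> module_iso R (modification R M I c) M'"
    "\<And>x. x \<in> carrier M \<Longrightarrow> \<phi> x = h (modification_map R M I c x)"
    using mod by (auto simp: is_modification_def)
  have h_hom: "h \<in> module_hom R (quotient_module ?Q ?K) M'"
    and h_bij: "bij_betw h (a_rcosets\<^bsub>?Q\<^esub> ?K) (carrier M')"
    using h(1) by (auto simp: module_iso_def modification_def quotient_module_def)
  \<comment> \<open>The projection to the quotient followed by the isomorphism is a surjection onto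
    \<open>M'\<close>, and injectivity of \<open>h\<close> identifies its fibres with the cosets of
    \<open>?K\<close>; \<open>G\<close> factors through it.\<close>
  have proj: "(\<lambda>q. h (?K +>\<^bsub>?Q\<^esub> q)) \<in> module_hom R ?Q M'"
    by (rule module_hom_comp[OF quotient_map_hom[OF Q.module_axioms K] h_hom])
  have "(\<lambda>q. h (?K +>\<^bsub>?Q\<^esub> q)) ` carrier ?Q = h ` (a_rcosets\<^bsub>?Q\<^esub> ?K)"
    by (auto simp: A_RCOSETS_def')
  then have surj: "(\<lambda>q. h (?K +>\<^bsub>?Q\<^esub> q)) ` carrier ?Q = carrier M'"
    using h_bij by (simp add: bij_betw_def)
  have ker: "G p = G q"
    if "p \<in> carrier ?Q" "q \<in> carrier ?Q" "h (?K +>\<^bsub>?Q\<^esub> p) = h (?K +>\<^bsub>?Q\<^esub> q)" for p q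
  proof -
    have "?K +>\<^bsub>?Q\<^esub> p = ?K +>\<^bsub>?Q\<^esub> q"
      using that(1,2)
      by (intro inj_onD[OF bij_betw_imp_inj_on[OF h_bij] that(3)]) (auto simp: A_RCOSETS_def')
    then show ?thesis
      using module_hom_const_on_cosets[OF Q.module_axioms B.module_axioms G rels G0 that(1,2)]
      by (simp add: modification_kernel_def)
  qed
  obtain g' where g': "g' \<in> module_hom R M' B"
    "\<forall>q\<in>carrier ?Q. g' (h (?K +>\<^bsub>?Q\<^esub> q)) = G q"
    using module_hom_factor[OF proj surj Q.add.m_closed Q.smult_closed G ker] ..
  have "g' (\<phi> y) = g y" if y: "y \<in> carrier M" for y
  proof -
    let ?F = "free_module R ?X"
    note F = module_free_module[OF M.R.is_cring, of ?X]
    have "(y, \<zero>\<^bsub>?F\<^esub>) \<in> carrier ?Q"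
      unfolding modification_sum_def by (rule module_homD(1)[OF direct_sum_inl_hom[OF M F] y])
    \<comment> \<open>On \<open>M\<close> the modification map is the inclusion as first summand
      followed by the projection, and the linear extension vanishes at the zero of the free
      module.\<close>
    then have "g' (\<phi> y) = G (y, \<zero>\<^bsub>?F\<^esub>)"
      using bspec[OF g'(2), of "(y, \<zero>\<^bsub>?F\<^esub>)"] by (simp add: h(2)[OF y] modification_map_def free_module_def)
    then show ?thesis
      using y module_hom_zero[OF F B.module_axioms free_ext_hom[OF B.module_axioms e]]
      by (simp add: G_def module_homD[OF g])
  qed
  with g'(1) show ?thesis by (rule that)
qed

text \<open>The map is the inclusion into the direct sum, followed by the projection and the
  isomorphism. The hypothesis \<open>params\<close> places the relators in the direct sum, so that
  the kernel is a submodule. Since \<open>\<phi>\<close> is prescribed only on the carrier of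
  \<open>M\<close>, linearity is transferred pointwise at the end.\<close>

lemma modification_hom:
  assumes M: "module R M" and M': "module R M'" and mod: "is_modification R M I c \<phi> M'"
    and params: "\<And>i. i \<in> I \<Longrightarrow> set (params (c i)) \<subseteq> carrier R"
  shows "\<phi> \<in> module_hom R M M'"
proof -
  interpret M: module R M by fact
  let ?Q = "modification_sum R M I c"
  interpret Q: module R ?Q by (rule module_modification_sum[OF M])
  let ?X = "{(i, j). i \<in> I \<and> j < length (rhs_elts (c i))}"
  have rel: "holds_param_relation R M (c i)" if "i \<in> I" for i
    using mod that by (simp add: is_modification_def)
  have K: "submodule (modification_kernel R M I c) R ?Q"
    unfolding modification_kernel_def
    by (rule submodule_submodule_gen[OF Q.module_axioms modification_relator_closed[OF M rel params]])
  obtain h where h: "h \<in> module_iso R (modification R M I c) M'"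
    "\<And>x. x \<in> carrier M \<Longrightarrow> \<phi> x = h (modification_map R M I c x)"
    using mod by (auto simp: is_modification_def)
  have "(\<lambda>x. (x, \<zero>\<^bsub>free_module R ?X\<^esub>)) \<in> module_hom R M ?Q"
    unfolding modification_sum_def
    by (rule direct_sum_inl_hom[OF M module_free_module[OF M.R.is_cring]])
  from module_hom_comp[OF this quotient_map_hom[OF Q.module_axioms K]]
  have "modification_map R M I c \<in> module_hom R M (modification R M I c)"
    by (simp add: modification_map_def[abs_def] modification_def free_module_def)
  from module_hom_comp[OF this, of h M'] h(1)
  have "(\<lambda>x. h (modification_map R M I c x)) \<in> module_hom R M M'"
    by (simp add: module_iso_def)
  then show ?thesis
    using h(2) by (auto simp: module_hom_def Pi_iff)
qed

section \<open>Homomorphisms out of a direct limit\<close>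

locale direct_system =
  fixes R :: "('a, 'r) ring_scheme"
    and M :: "nat \<Rightarrow> ('a, 'm) module"
    and \<phi> :: "nat \<Rightarrow> 'm \<Rightarrow> 'm"
  assumes module_M: "module R (M t)"
    and hom_\<phi>: "\<phi> t \<in> module_hom R (M t) (M (Suc t))"
begin

section \<open>Transition maps and equality of limit classes\<close>

lemma transition_refl [simp]: "transition \<phi> t t x = x"
  by (simp add: transition_def)

lemma transition_Suc: "t \<le> r \<Longrightarrow> transition \<phi> t (Suc r) x = \<phi> r (transition \<phi> t r x)"
  by (simp add: transition_def)

lemma transition_hom: "t \<le> r \<Longrightarrow> transition \<phi> t r \<in> module_hom R (M t) (M r)"
proof (induction r rule: dec_induct)
  case base
  show ?case by (simp add: module_hom_def)
next
  case (step r)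
  have "transition \<phi> t (Suc r) = (\<lambda>x. \<phi> r (transition \<phi> t r x))"
    using step.hyps by (simp add: fun_eq_iff transition_Suc)
  then show ?case using module_hom_comp[OF step.IH hom_\<phi>] by simp
qed

lemmas transition_homD = module_homD[OF transition_hom]

lemma transition_trans:
  assumes "t \<le> r" "r \<le> q"
  shows "transition \<phi> r q (transition \<phi> t r x) = transition \<phi> t q x"
  using assms(2,1) by (induction q rule: dec_induct) (simp_all add: transition_Suc)

lemma limit_class_self: "x \<in> carrier (M t) \<Longrightarrow> (t, x) \<in> limit_class M \<phi> t x"
  by (auto simp: limit_class_def)

text \<open>Equality at one stage persists at all later stages. In this form several identifications
  can be compared at the maximum of their stages.\<close>

lemma limit_class_memE:
  assumes "(s, y) \<in> limit_class M \<phi> t x"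
  obtains r where "y \<in> carrier (M s)"
    "\<And>q. r \<le> q \<Longrightarrow> t \<le> q \<and> s \<le> q \<and> transition \<phi> t q x = transition \<phi> s q y"
proof -
  obtain r where y: "y \<in> carrier (M s)" and r: "t \<le> r" "s \<le> r"
    and eq: "transition \<phi> t r x = transition \<phi> s r y"
    using assms by (auto simp: limit_class_def)
  have "t \<le> q \<and> s \<le> q \<and> transition \<phi> t q x = transition \<phi> s q y" if "r \<le> q" for q
    using r that eq transition_trans[OF r(1) that] transition_trans[OF r(2) that]
    by (metis order_trans)
  with y show ?thesis by (rule that)
qed

lemma limit_class_subset:
  assumes "t \<le> r" "s \<le> r" "transition \<phi> t r x = transition \<phi> s r y"
  shows "limit_class M \<phi> t x \<subseteq> limit_class M \<phi> s y"
proof clarify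
  fix u z assume "(u, z) \<in> limit_class M \<phi> t x"
  then obtain q where z: "z \<in> carrier (M u)"
    and q: "\<And>p. q \<le> p \<Longrightarrow> t \<le> p \<and> u \<le> p \<and> transition \<phi> t p x = transition \<phi> u p z"
    by (rule limit_class_memE) blast
  let ?p = "max r q"
  have "transition \<phi> s ?p y = transition \<phi> t ?p x"
    using assms transition_trans[of t r ?p x] transition_trans[of s r ?p y] by simp
  then have "s \<le> ?p" "u \<le> ?p" "transition \<phi> s ?p y = transition \<phi> u ?p z"
    using q[of ?p] assms(2) by auto
  then show "(u, z) \<in> limit_class M \<phi> s y" using z unfolding limit_class_def by blast
qed

lemma limit_class_eqI:
  assumes "t \<le> r" "s \<le> r" "transition \<phi> t r x = transition \<phi> s r y"
  shows "limit_class M \<phi> t x = limit_class M \<phi> s y"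
  using limit_class_subset[OF assms] limit_class_subset[OF assms(2,1) assms(3)[symmetric]]
  by blast

text \<open>The union in the definition of addition is over a single class: for any two choices of
  representatives and of a stage, the sums agree once pushed to a later common stage. The stage
  \<open>r\<close> is left free so that it can be chosen where the lemma is applied.\<close>

lemma direct_limit_add:
  assumes x: "x \<in> carrier (M t)" and y: "y \<in> carrier (M s)" and r: "t \<le> r" "s \<le> r"
  shows "limit_class M \<phi> t x \<oplus>\<^bsub>direct_limit M \<phi>\<^esub> limit_class M \<phi> s y
    = limit_class M \<phi> r (transition \<phi> t r x \<oplus>\<^bsub>M r\<^esub> transition \<phi> s r y)"
proof -
  have indep: "limit_class M \<phi> r' (transition \<phi> t' r' x' \<oplus>\<^bsub>M r'\<^esub> transition \<phi> s' r' y')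
      = limit_class M \<phi> r (transition \<phi> t r x \<oplus>\<^bsub>M r\<^esub> transition \<phi> s r y)"
    if mem: "(t', x') \<in> limit_class M \<phi> t x" "(s', y') \<in> limit_class M \<phi> s y"
      and r': "t' \<le> r'" "s' \<le> r'" for t' x' s' y' r'
  proof -
    obtain q1 where x': "x' \<in> carrier (M t')"
      and q1: "\<And>q. q1 \<le> q \<Longrightarrow> t \<le> q \<and> t' \<le> q \<and> transition \<phi> t q x = transition \<phi> t' q x'"
      using mem(1) by (rule limit_class_memE) blast
    obtain q2 where y': "y' \<in> carrier (M s')"
      and q2: "\<And>q. q2 \<le> q \<Longrightarrow> s \<le> q \<and> s' \<le> q \<and> transition \<phi> s q y = transition \<phi> s' q y'"
      using mem(2) by (rule limit_class_memE) blast
    \<comment> \<open>A stage late enough for both identifications and beyond both stages where the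
      sums are formed.\<close>
    define q where "q = Max {q1, q2, r, r'}"
    have q: "q1 \<le> q" "q2 \<le> q" "r \<le> q" "r' \<le> q" by (simp_all add: q_def)
    have "transition \<phi> r' q (transition \<phi> t' r' x' \<oplus>\<^bsub>M r'\<^esub> transition \<phi> s' r' y')
        = transition \<phi> t' q x' \<oplus>\<^bsub>M q\<^esub> transition \<phi> s' q y'"
      using q r' x' y' by (simp add: transition_homD transition_trans)
    moreover have "transition \<phi> r q (transition \<phi> t r x \<oplus>\<^bsub>M r\<^esub> transition \<phi> s r y)
        = transition \<phi> t q x \<oplus>\<^bsub>M q\<^esub> transition \<phi> s q y"
      using q r x y by (simp add: transition_homD transition_trans)
    ultimately show ?thesis
      using q1[OF q(1)] q2[OF q(2)] by (intro limit_class_eqI[OF q(4,3)]) simp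
  qed
  let ?Z = "limit_class M \<phi> r (transition \<phi> t r x \<oplus>\<^bsub>M r\<^esub> transition \<phi> s r y)"
  have "{limit_class M \<phi> r' (transition \<phi> t' r' x' \<oplus>\<^bsub>M r'\<^esub> transition \<phi> s' r' y') | t' x' s' y' r'.
      (t', x') \<in> limit_class M \<phi> t x \<and> (s', y') \<in> limit_class M \<phi> s y \<and> t' \<le> r' \<and> s' \<le> r'}
      = {?Z}" (is "?A = _")
  proof (intro equalityI subsetI)
    fix U assume "U \<in> ?A"
    then obtain t' x' s' y' r' where
      "U = limit_class M \<phi> r' (transition \<phi> t' r' x' \<oplus>\<^bsub>M r'\<^esub> transition \<phi> s' r' y')"
      "(t', x') \<in> limit_class M \<phi> t x" "(s', y') \<in> limit_class M \<phi> s y" "t' \<le> r'" "s' \<le> r'"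
      by blast
    then show "U \<in> {?Z}" using indep by simp
  next
    fix U assume "U \<in> {?Z}"
    then have "U = ?Z" by simp
    then show "U \<in> ?A" using limit_class_self[OF x] limit_class_self[OF y] r by blast
  qed
  then show ?thesis by (simp add: direct_limit_def)
qed

lemma direct_limit_smult:
  assumes a: "a \<in> carrier R" and x: "x \<in> carrier (M t)"
  shows "a \<odot>\<^bsub>direct_limit M \<phi>\<^esub> limit_class M \<phi> t x = limit_class M \<phi> t (a \<odot>\<^bsub>M t\<^esub> x)"
proof -
  have indep: "limit_class M \<phi> s (a \<odot>\<^bsub>M s\<^esub> y) = limit_class M \<phi> t (a \<odot>\<^bsub>M t\<^esub> x)"
    if mem: "(s, y) \<in> limit_class M \<phi> t x" for s y
  proof -
    obtain q where y: "y \<in> carrier (M s)"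
      and q: "\<And>p. q \<le> p \<Longrightarrow> t \<le> p \<and> s \<le> p \<and> transition \<phi> t p x = transition \<phi> s p y"
      using mem by (rule limit_class_memE) blast
    show ?thesis
      using q[of q] a x y by (intro limit_class_eqI[of s q t]) (simp_all add: transition_homD)
  qed
  have "{limit_class M \<phi> s (a \<odot>\<^bsub>M s\<^esub> y) | s y. (s, y) \<in> limit_class M \<phi> t x}
      = {limit_class M \<phi> t (a \<odot>\<^bsub>M t\<^esub> x)}"
    using indep limit_class_self[OF x] by blast
  then show ?thesis by (simp add: direct_limit_def)
qed

section \<open>Closure under the operations and the universal property of the direct limit\<close>

lemma limit_class_closed:
  "x \<in> carrier (M t) \<Longrightarrow> limit_class M \<phi> t x \<in> carrier (direct_limit M \<phi>)"
  by (auto simp: direct_limit_def)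

lemma direct_limit_cases:
  assumes "X \<in> carrier (direct_limit M \<phi>)"
  obtains t x where "x \<in> carrier (M t)" "X = limit_class M \<phi> t x"
  using assms by (auto simp: direct_limit_def)

lemma direct_limit_add_closed:
  assumes "X \<in> carrier (direct_limit M \<phi>)" "Y \<in> carrier (direct_limit M \<phi>)"
  shows "X \<oplus>\<^bsub>direct_limit M \<phi>\<^esub> Y \<in> carrier (direct_limit M \<phi>)"
proof -
  obtain t x where X: "x \<in> carrier (M t)" "X = limit_class M \<phi> t x"
    using assms(1) by (rule direct_limit_cases)
  obtain s y where Y: "y \<in> carrier (M s)" "Y = limit_class M \<phi> s y"
    using assms(2) by (rule direct_limit_cases)
  interpret M: module R "M (max t s)" by (rule module_M)
  show ?thesis
    unfolding X(2) Y(2) direct_limit_add[OF X(1) Y(1) max.cobounded1 max.cobounded2]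
    using X Y by (intro limit_class_closed M.add.m_closed) (simp_all add: transition_homD)
qed

lemma direct_limit_smult_closed:
  assumes a: "a \<in> carrier R" and X: "X \<in> carrier (direct_limit M \<phi>)"
  shows "a \<odot>\<^bsub>direct_limit M \<phi>\<^esub> X \<in> carrier (direct_limit M \<phi>)"
proof -
  obtain t x where x: "x \<in> carrier (M t)" "X = limit_class M \<phi> t x"
    using X by (rule direct_limit_cases)
  interpret M: module R "M t" by (rule module_M)
  show ?thesis
    unfolding x(2) direct_limit_smult[OF a x(1)] using a x(1) by (intro limit_class_closed) simp
qed

text \<open>A compatible family is constant along transition maps, so its value at a class does not
  depend on the representative. Any two classes have representatives at a common stage, where
  additivity is inherited from \<open>N\<close>-valued linear maps.\<close>

lemma direct_limit_hom_exists:
  assumes g: "\<And>t. g t \<in> module_hom R (M t) N"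
    and compat: "\<And>t x. x \<in> carrier (M t) \<Longrightarrow> g (Suc t) (\<phi> t x) = g t x"
  shows "\<exists>G\<in>module_hom R (direct_limit M \<phi>) N.
    \<forall>t. \<forall>x\<in>carrier (M t). G (limit_class M \<phi> t x) = g t x"
proof -
  have g_transition: "g r (transition \<phi> t r x) = g t x" if "t \<le> r" "x \<in> carrier (M t)" for t r x
    using that by (induction r rule: dec_induct) (simp_all add: transition_Suc compat transition_homD)
  \<comment> \<open>An arbitrary representative is chosen; two representatives agree at a later
    stage, where \<open>g_transition\<close> gives equal values.\<close>
  define G where "G = (\<lambda>X. case SOME p. p \<in> X of (t, x) \<Rightarrow> g t x)"
  have G: "G (limit_class M \<phi> t x) = g t x" if x: "x \<in> carrier (M t)" for t x
  proof -
    obtain s y where sy: "(SOME p. p \<in> limit_class M \<phi> t x) = (s, y)" by fastforce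
    then have "(s, y) \<in> limit_class M \<phi> t x"
      using someI[of "\<lambda>p. p \<in> limit_class M \<phi> t x", OF limit_class_self[OF x]] by simp
    then obtain r where y: "y \<in> carrier (M s)"
      and r: "\<And>q. r \<le> q \<Longrightarrow> t \<le> q \<and> s \<le> q \<and> transition \<phi> t q x = transition \<phi> s q y"
      by (rule limit_class_memE) blast
    have "g s y = g t x"
      using g_transition[of t r x] g_transition[of s r y] r[of r] x y by simp
    then show ?thesis by (simp add: G_def sy)
  qed
  have "G \<in> module_hom R (direct_limit M \<phi>) N"
  proof (rule module_homI)
    fix X assume "X \<in> carrier (direct_limit M \<phi>)"
    then obtain t x where X: "x \<in> carrier (M t)" "X = limit_class M \<phi> t x"
      by (rule direct_limit_cases)
    show "G X \<in> carrier N" using X module_homD(1)[OF g] by (simp add: G)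
    interpret M: module R "M t" by (rule module_M)
    show "G (a \<odot>\<^bsub>direct_limit M \<phi>\<^esub> X) = a \<odot>\<^bsub>N\<^esub> G X" if "a \<in> carrier R" for a
      using X that by (simp add: direct_limit_smult G module_homD[OF g])
    fix Y assume "Y \<in> carrier (direct_limit M \<phi>)"
    then obtain s y where Y: "y \<in> carrier (M s)" "Y = limit_class M \<phi> s y"
      by (rule direct_limit_cases)
    interpret M': module R "M (max t s)" by (rule module_M)
    show "G (X \<oplus>\<^bsub>direct_limit M \<phi>\<^esub> Y) = G X \<oplus>\<^bsub>N\<^esub> G Y"
      using X Y
      by (simp add: direct_limit_add[where r = "max t s"] G transition_homD module_homD[OF g]
          g_transition)
  qed
  with G show ?thesis by blast
qed

end

section \<open>The comparison of closures\<close>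

text \<open>The element \<open>s\<close> is fixed before \<open>s'\<close>: it is the image of 1
  under R = M_0 and the canonical map to the limit. Only the homomorphism depends on
  \<open>s'\<close>.\<close>

lemma constructed_by_modifications_homs:
  assumes B: "big_CM_module R B" and B': "big_CM_module R B'"
    and constr: "constructed_by_modifications R M I c \<phi> B"
  shows "\<exists>s\<in>carrier B. \<forall>s'\<in>carrier B'. \<exists>h\<in>module_hom R B B'. h s = s'"
proof -
  interpret B': module R B' using B' by (simp add: big_CM_module_def)
  have M: "module R (M t)" and modif: "is_modification R (M t) (I t) (c t) (\<phi> t) (M (Suc t))" for t
    using constr by (auto simp: constructed_by_modifications_def)
  interpret direct_system R M \<phi>
  proof (rule direct_system.intro)
    fix t
    show "module R (M t)" by (rule M)
    show "\<phi> t \<in> module_hom R (M t) (M (Suc t))"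
    proof (rule modification_hom[OF M M modif])
      show "set (params (c t i)) \<subseteq> carrier R" if "i \<in> I t" for i
        using modif[of t] that big_CM_module_params_closed[OF B]
        by (simp add: is_modification_def holds_param_relation_def)
    qed
  qed
  let ?R = "regular_module R" and ?L = "direct_limit M \<phi>"
  obtain \<iota> where \<iota>: "\<iota> \<in> module_iso R ?R (M 0)"
    using constr by (auto simp: constructed_by_modifications_def)
  obtain k where k: "k \<in> module_iso R ?L B"
    using constr by (auto simp: constructed_by_modifications_def)
  have \<iota>_hom: "\<iota> \<in> module_hom R ?R (M 0)" and \<iota>_bij: "bij_betw \<iota> (carrier R) (carrier (M 0))"
    using \<iota> by (auto simp: module_iso_def regular_module_def)
  have k_hom: "k \<in> module_hom R ?L B" and k_bij: "bij_betw k (carrier ?L) (carrier B)"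
    using k by (auto simp: module_iso_def)
  have one: "\<iota> \<one>\<^bsub>R\<^esub> \<in> carrier (M 0)"
    using \<iota>_bij by (auto simp: bij_betw_def)
  let ?s = "k (limit_class M \<phi> 0 (\<iota> \<one>\<^bsub>R\<^esub>))"
  have "\<exists>h\<in>module_hom R B B'. h ?s = s'" if s': "s' \<in> carrier B'" for s'
  proof -
    have "(\<lambda>a. a \<odot>\<^bsub>B'\<^esub> s') \<in> module_hom R ?R B'"
      using s' by (intro module_homI)
        (auto simp: regular_module_def B'.smult_l_distr B'.smult_assoc1)
    \<comment> \<open>The map from R that sends 1 to \<open>s'\<close> is transported along the
      isomorphism \<open>\<iota>\<close> to stage 0.\<close>
    then have "\<exists>g\<in>module_hom R (M 0) B'. \<forall>a\<in>carrier ?R. g (\<iota> a) = a \<odot>\<^bsub>B'\<^esub> s'"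
      by (intro module_hom_factor[OF \<iota>_hom])
        (use \<iota>_bij in \<open>auto simp: regular_module_def bij_betw_def dest: inj_onD\<close>)
    then obtain g0 where g0: "g0 \<in> module_hom R (M 0) B'" "g0 (\<iota> \<one>\<^bsub>R\<^esub>) = s'"
      using s' by (auto simp: regular_module_def)
    \<comment> \<open>The coefficients in an extension are a choice, so the family comes from
      dependent choice. The clause for t = 0 in the invariant pins the start to
      \<open>g0\<close>.\<close>
    have "\<exists>g. \<forall>t. (g t \<in> module_hom R (M t) B' \<and> (t = 0 \<longrightarrow> g t = g0))
        \<and> (\<forall>x\<in>carrier (M t). g (Suc t) (\<phi> t x) = g t x)"
    proof (rule dependent_nat_choice)
      show "\<exists>g. g \<in> module_hom R (M 0) B' \<and> (0 = (0::nat) \<longrightarrow> g = g0)" using g0(1) by blast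
    next
      fix g t assume "g \<in> module_hom R (M t) B' \<and> (t = 0 \<longrightarrow> g = g0)"
      then have "g \<in> module_hom R (M t) B'" by blast
      then obtain g' where "g' \<in> module_hom R (M (Suc t)) B'"
        "\<And>x. x \<in> carrier (M t) \<Longrightarrow> g' (\<phi> t x) = g x"
        using modification_extend_hom[OF M M modif B'] by blast
      then show "\<exists>g'. (g' \<in> module_hom R (M (Suc t)) B' \<and> (Suc t = 0 \<longrightarrow> g' = g0))
          \<and> (\<forall>x\<in>carrier (M t). g' (\<phi> t x) = g x)"
        by auto
    qed
    then obtain g where g: "\<And>t. g t \<in> module_hom R (M t) B'" "g 0 = g0"
      "\<And>t x. x \<in> carrier (M t) \<Longrightarrow> g (Suc t) (\<phi> t x) = g t x"
      by blast
    obtain G where G: "G \<in> module_hom R ?L B'"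
      "\<forall>t. \<forall>x\<in>carrier (M t). G (limit_class M \<phi> t x) = g t x"
      using direct_limit_hom_exists[of g B', OF g(1,3)] by blast
    \<comment> \<open>Injectivity of \<open>k\<close> makes the fibre condition trivial, so
      \<open>G\<close> passes from the limit to \<open>B\<close>.\<close>
    have "\<exists>h\<in>module_hom R B B'. \<forall>X\<in>carrier ?L. h (k X) = G X"
      using k_bij
      by (intro module_hom_factor[OF k_hom _ direct_limit_add_closed direct_limit_smult_closed G(1)])
        (auto simp: bij_betw_def dest: inj_onD)
    then show ?thesis
      using G(2) one g(2) g0(2) limit_class_closed[OF one] by fastforce
  qed
  moreover have "?s \<in> carrier B"
    by (rule module_homD(1)[OF k_hom limit_class_closed[OF one]])
  ultimately show ?thesis by blast
qed

lemma closure_le_constructed: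
  assumes "big_CM_module R B" "constructed_by_modifications R M I c \<phi> B" "big_CM_module R B'"
  shows "closure_le R (module_closure R B) (module_closure R B')"
proof -
  obtain s where "s \<in> carrier B" "\<forall>s'\<in>carrier B'. \<exists>h\<in>module_hom R B B'. h s = s'"
    using constructed_by_modifications_homs[OF assms(1,3,2)] by blast
  then show ?thesis
    using assms(1,3) by (intro closure_le_if_homs) (auto simp: big_CM_module_def)
qed

theorem proposition4p14:
  fixes R :: "('a, 'r) ring_scheme"
    and B :: "('a, 'b) module"
    and M :: "nat \<Rightarrow> ('a, 'm) module"
    and I :: "nat \<Rightarrow> 'i set"
    and c :: "nat \<Rightarrow> 'i \<Rightarrow> ('a, 'm) param_relation"
    and \<phi> :: "nat \<Rightarrow> 'm \<Rightarrow> 'm"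
  assumes "local_ring R" and "domain R"
    and "big_CM_module R B"
    and "constructed_by_modifications R M I c \<phi> B"
  shows "(\<forall>B' :: ('a, 'c) module. big_CM_module R B' \<longrightarrow>
            closure_le R (module_closure R B :: ('a, 'd) module \<Rightarrow> 'd set \<Rightarrow> 'd set)
              (module_closure R B'))
       \<and> (module_closure R B :: ('a, 'd) module \<Rightarrow> 'd set \<Rightarrow> 'd set)
            \<in> big_CM_module_closures TYPE('b) R
       \<and> (\<forall>cl \<in> big_CM_module_closures TYPE('c) R.
            closure_le R (module_closure R B :: ('a, 'd) module \<Rightarrow> 'd set \<Rightarrow> 'd set) cl)"
  \<comment> \<open>\<open>B\<close> itself witnesses that its closure is a big Cohen-Macaulay
    module closure, and any other such closure comes from some \<open>B'\<close>, so minimality is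
    the first claim again.\<close>
  using closure_le_constructed[OF assms(3,4)] assms(3)
  by (auto simp: big_CM_module_closures_def)

end
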